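(* Let $X\subseteq\mathbb{R}^2$ be a connected closed region whose obstacle set $\mathbb{R}^2\setminus X$ is bounded by finitely many line segments, rays and lines, let $\alpha>1$, and consider the pursuit-evasion game on $X$ with capture radius $0$, initial time $t_0$ and initial state $\mathbf{x}_0=(x_{p0},x_{e0})\in X\times X$, $x_{p0}\ne x_{e0}$. Let $x_{c1},x_{c2}\in\partial\mathcal{D}(x_{p0},x_{e0})$, and suppose that $d_L$ is continuously differentiable near $(x_{c1},x_{p0})$ and $(x_{c2},x_{p0})$. If there exists a non-anticipative strategy $\delta_p\in\Delta^{t_0}(\mathbf{x}_0)$ of the pursuer such that for all $u_e\in\mathcal{U}^e_{t_0}(x_{e0})$ and all $t\in[t_0,t_f(\delta_p[u_e],u_e))$ one has $x_e(t;u_e)\in\mathcal{D}(x_{p0},x_{e0})$, then $$\partial_2 d_L(x_{c1},x_{p0})\cdot\partial_2 d_L(x_{c2},x_{p0})-\partial_2 d_L(x_{c1},x_{e0})\cdot\partial_2 d_L(x_{c2},x_{e0})\ge 0.$$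
   Context: Game. The pursuer and evader move in $X$ with $\dot x_p(t)=\alpha u_p(t)$, $\dot x_e(t)=u_e(t)$, $x_p(t_0)=x_{p0}$, $x_e(t_0)=x_{e0}$, $\alpha>1$, and may not leave $X$. $\mathcal{U}_{t_0}$ is the set of piecewise continuous functions $u:[t_0,+\infty)\to\{v\in\mathbb{R}^2:\|v\|=1\}$; $\mathcal{U}^p_{t_0}(x_{p0}),\mathcal{U}^e_{t_0}(x_{e0})\subseteq\mathcal{U}_{t_0}$ are the sets of admissible controls, i.e. those whose trajectory stays in $X$. Trajectories are denoted $x_p(t;u_p)$, $x_e(t;u_e)$. The terminal time is $t_f(u_p,u_e)=\inf\{t\ge t_0:x_p(t;u_p)=x_e(t;u_e)\}$ ($\inf\emptyset=+\infty$). Non-anticipative strategies. $\Delta^{t_0}(\mathbf{x}_0)$ is the set of maps $\delta:\mathcal{U}^e_{t_0}(x_{e0})\to\mathcal{U}^p_{t_0}(x_{p0})$ such that for all $t'>t_0$: if $u_e=u_e'$ a.e. on $[t_0,t']$, then $\delta[u_e]=\delta[u_e']$ a.e. on $[t_0,t']$. Distance and dominance region. $d_L(x_1,x_2)$ is the infimum of lengths of continuous piecewise smooth curves in $X$ joining $x_1,x_2\in X$; $\partial_i d_L$ denotes the gradient of $d_L$ with respect to its $i$-th argument ($i=1,2$). $\mathcal{D}(x_1,x_2)=\{x\in X:d_L(x,x_1)-\alpha d_L(x,x_2)>0\}$, and its boundary (relative to $X$) is $\partial\mathcal{D}(x_1,x_2)=\{x\in X:d_L(x,x_1)-\alpha d_L(x,x_2)=0\}$.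 *)

theory Defs
  imports "HOL-Analysis.Analysis"
begin

type_synonym plane = "real ^ 2"

section \<open>Polygonal regions and the intrinsic distance\<close>

definition is_segment :: "plane set \<Rightarrow> bool" where
  "is_segment S \<longleftrightarrow> (\<exists>a b. a \<noteq> b \<and> S = closed_segment a b)"

definition is_ray :: "plane set \<Rightarrow> bool" where
  "is_ray S \<longleftrightarrow> (\<exists>a v. v \<noteq> 0 \<and> S = {a + s *\<^sub>R v | s. s \<ge> 0})"

definition is_line :: "plane set \<Rightarrow> bool" where
  "is_line S \<longleftrightarrow> (\<exists>a v. v \<noteq> 0 \<and> S = {a + s *\<^sub>R v | s. True})"

definition polygonal_region :: "plane set \<Rightarrow> bool" where
  "polygonal_region X \<longleftrightarrow> closed X \<and> connected X \<and>
     (\<exists>\<L>. finite \<L> \<and> (\<forall>S\<in>\<L>. is_segment S \<or> is_ray S \<or> is_line S) \<and>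
          frontier (- X) = \<Union>\<L>)"

(* The length is required to exist (has_integral) rather than being written with
   the total operator "integral": valid_path only asks for C1 off a finite set,
   so the speed may fail to be integrable, and "integral" would then return 0. *)
definition curve_lengths :: "plane set \<Rightarrow> plane \<Rightarrow> plane \<Rightarrow> real set" where
  "curve_lengths X x1 x2 = {l. \<exists>g. valid_path g \<and> path_image g \<subseteq> X \<and>
     pathstart g = x1 \<and> pathfinish g = x2 \<and>
     ((\<lambda>t. norm (vector_derivative g (at t))) has_integral l) {0..1}}"

definition dL :: "plane set \<Rightarrow> plane \<Rightarrow> plane \<Rightarrow> real" where
  "dL X x1 x2 = Inf (curve_lengths X x1 x2)"

section \<open>Gradients on closed sets\<close>

(* The intrinsic distance is only defined on X, whose boundary points are allowed
   positions, so derivatives are taken within the domain S. At interior points this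
   is the usual gradient. At other points a derivative within S determines a
   gradient only if S is not too thin there (think of a point inside a segment sticking out
   of S); hence the condition that x is a limit of interior points of S. *)
definition has_gradient_within ::
    "('a::euclidean_space \<Rightarrow> real) \<Rightarrow> 'a \<Rightarrow> 'a set \<Rightarrow> 'a \<Rightarrow> bool" where
  "has_gradient_within f g S x \<longleftrightarrow>
     x \<in> S \<and> x \<in> closure (interior S) \<and> (f has_derivative (\<lambda>h. h \<bullet> g)) (at x within S)"

lemma has_gradient_within_interior:
  assumes "x \<in> interior S"
  shows "has_gradient_within f g S x \<longleftrightarrow> GDERIV f x :> g"
proof -
  have "x \<in> S" "x \<in> closure (interior S)"
    using assms interior_subset closure_subset by blast+
  then show ?thesis
    unfolding has_gradient_within_def gderiv_def at_within_interior[OF assms] by blast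
qed

definition continuously_differentiable_near ::
    "('a::euclidean_space \<Rightarrow> real) \<Rightarrow> 'a set \<Rightarrow> 'a \<Rightarrow> bool" where
  "continuously_differentiable_near f S x \<longleftrightarrow>
     (\<exists>U G. open U \<and> x \<in> U \<and> continuous_on (U \<inter> S) G \<and>
            (\<forall>y \<in> U \<inter> S. has_gradient_within f (G y) S y))"

definition grad2_dL :: "plane set \<Rightarrow> plane \<Rightarrow> plane \<Rightarrow> plane" where
  "grad2_dL X x1 x2 = (THE g. has_gradient_within (\<lambda>y. dL X x1 y) g X x2)"

section \<open>Dominance region\<close>

definition dominance :: "plane set \<Rightarrow> real \<Rightarrow> plane \<Rightarrow> plane \<Rightarrow> plane set" where
  "dominance X \<alpha> x1 x2 = {x \<in> X. dL X x x1 - \<alpha> * dL X x x2 > 0}"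

definition dominance_boundary :: "plane set \<Rightarrow> real \<Rightarrow> plane \<Rightarrow> plane \<Rightarrow> plane set" where
  "dominance_boundary X \<alpha> x1 x2 = {x \<in> X. dL X x x1 - \<alpha> * dL X x x2 = 0}"

section \<open>The game\<close>

definition piecewise_continuous_from :: "real \<Rightarrow> (real \<Rightarrow> plane) \<Rightarrow> bool" where
  "piecewise_continuous_from t0 u \<longleftrightarrow>
     (\<forall>T. finite {t \<in> {t0..T}. \<not> continuous (at t within {t0..}) u}) \<and>
     (\<forall>t\<ge>t0. \<exists>l. (u \<longlongrightarrow> l) (at_right t)) \<and>
     (\<forall>t>t0. \<exists>l. (u \<longlongrightarrow> l) (at_left t))"

definition controls :: "real \<Rightarrow> (real \<Rightarrow> plane) set" where
  "controls t0 = {u \<in> {t0..} \<rightarrow>\<^sub>E sphere 0 1. piecewise_continuous_from t0 u}"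

(* Solution of x' = s * u(t), x(t0) = x0; the speed s is \<alpha> for the pursuer
   and 1 for the evader. *)
definition trajectory :: "real \<Rightarrow> real \<Rightarrow> plane \<Rightarrow> (real \<Rightarrow> plane) \<Rightarrow> real \<Rightarrow> plane" where
  "trajectory s t0 x0 u t = x0 + s *\<^sub>R integral {t0..t} u"

definition admissible_controls ::
    "plane set \<Rightarrow> real \<Rightarrow> real \<Rightarrow> plane \<Rightarrow> (real \<Rightarrow> plane) set" where
  "admissible_controls X s t0 x0 = {u \<in> controls t0. \<forall>t\<ge>t0. trajectory s t0 x0 u t \<in> X}"

definition terminal_time ::
    "real \<Rightarrow> real \<Rightarrow> plane \<Rightarrow> plane \<Rightarrow> (real \<Rightarrow> plane) \<Rightarrow> (real \<Rightarrow> plane) \<Rightarrow> ereal" where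
  "terminal_time \<alpha> t0 xp0 xe0 up ue =
     Inf (ereal ` {t. t \<ge> t0 \<and> trajectory \<alpha> t0 xp0 up t = trajectory 1 t0 xe0 ue t})"

definition nonanticipative_strategies ::
    "plane set \<Rightarrow> real \<Rightarrow> real \<Rightarrow> plane \<Rightarrow> plane \<Rightarrow> ((real \<Rightarrow> plane) \<Rightarrow> (real \<Rightarrow> plane)) set" where
  "nonanticipative_strategies X \<alpha> t0 xp0 xe0 =
     {\<delta> \<in> admissible_controls X 1 t0 xe0 \<rightarrow> admissible_controls X \<alpha> t0 xp0.
        \<forall>t'>t0. \<forall>u \<in> admissible_controls X 1 t0 xe0. \<forall>u' \<in> admissible_controls X 1 t0 xe0.
          (AE t in lborel. t \<in> {t0..t'} \<longrightarrow> u t = u' t) \<longrightarrow>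
          (AE t in lborel. t \<in> {t0..t'} \<longrightarrow> \<delta> u t = \<delta> u' t)}"

end

theory Submission
  imports Defs
begin

text \<open>The evader runs along a nearly shortest path to \<open>xc1\<close> for a short time \<open>h\<close> and then along a
  nearly shortest path to \<open>xc2\<close>. Since \<open>xc1\<close> and \<open>xc2\<close> are not in the dominance region, capture has to
  occur by the time of arrival. By non-anticipation the pursuer's first move is the one it would
  make if the evader went on to \<open>xc1\<close>, so up to first order it moves in the direction
  \<open>- \<partial>\<^sub>2 d\<^sub>L(xc1, xp0)\<close> at speed \<open>\<alpha>\<close>, while the evader moves in the direction \<open>- \<partial>\<^sub>2 d\<^sub>L(xc1, xe0)\<close>.
  From there the pursuer still has to be at \<open>xc2\<close> in time, and comparing the first-order changes of the
  distances to \<open>xc2\<close> gives the inequality. That gradients have norm at most 1 also at boundary points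
  turns ``almost optimal progress'' into ``almost the gradient direction''; shortest paths are
  replaced by polygonal chains in \<open>X\<close>, which exist because \<open>X\<close> is locally star-shaped.\<close>

section \<open>Local shape of polygonal regions\<close>

text \<open>The shape information extracted from polygonality. All segments start at the point
  \<open>x\<close> itself: at a reflex corner \<open>X\<close> is star-shaped about the corner
  without being convex nearby.\<close>

definition locally_star_shaped :: "'a::real_normed_vector set \<Rightarrow> bool" where
  "locally_star_shaped X \<longleftrightarrow>
     (\<forall>x\<in>X. \<exists>r>0. \<forall>y\<in>X. dist x y < r \<longrightarrow> closed_segment x y \<subseteq> X)"

lemma locally_star_shapedE:
  assumes "locally_star_shaped X" "x \<in> X"
  obtains r where "r > 0" "\<And>y. y \<in> X \<Longrightarrow> dist x y < r \<Longrightarrow> closed_segment x y \<subseteq> X"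
  using assms unfolding locally_star_shaped_def by blast

text \<open>Take a ball about \<open>x\<close> that misses every boundary piece not containing
  \<open>x\<close>. If a segment from \<open>x\<close> to a point \<open>y\<close> of
  \<open>X\<close> in this ball left \<open>X\<close> at \<open>z\<close>, it would meet the
  frontier again at some \<open>p\<close> beyond \<open>z\<close>, on a piece \<open>S\<close> that
  contains \<open>x\<close>. By convexity \<open>z\<close> lies on \<open>S\<close>, hence in
  \<open>X\<close>.\<close>

lemma closed_convex_imp_locally_star_shaped:
  fixes X :: "'a::euclidean_space set"
  assumes "closed X" and fin: "finite \<L>" and cc: "\<And>S. S \<in> \<L> \<Longrightarrow> closed S \<and> convex S"
    and fr: "frontier X = \<Union>\<L>"
  shows "locally_star_shaped X"
  unfolding locally_star_shaped_def
proof
  fix x assume x: "x \<in> X"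
  have "open (- \<Union>{S\<in>\<L>. x \<notin> S})"
    using fin cc by (intro open_Compl closed_Union) auto
  moreover have "x \<in> - \<Union>{S\<in>\<L>. x \<notin> S}" by auto
  ultimately obtain r where r: "r > 0" "ball x r \<subseteq> - \<Union>{S\<in>\<L>. x \<notin> S}"
    by (meson open_contains_ball)
  have "closed_segment x y \<subseteq> X" if y: "y \<in> X" "dist x y < r" for y
  proof
    fix z assume z: "z \<in> closed_segment x y"
    show "z \<in> X"
    proof (rule ccontr)
      assume nz: "z \<notin> X"
      have "closed_segment z y \<inter> frontier X \<noteq> {}"
        using y nz by (intro connected_Int_frontier) auto
      then obtain p S where p: "p \<in> closed_segment z y" "p \<in> S" "S \<in> \<L>"
        using fr by auto
      have "p \<in> closed_segment x y"
        using p(1) z by (meson ends_in_segment(2) subset_closed_segment subsetD)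
      then have "dist x p \<le> dist x y"
        by (metis dist_commute dist_in_closed_segment(1))
      then have "p \<in> ball x r" using y by simp
      then have "x \<in> S" using r p by blast
      obtain a where a: "0 \<le> a" "a \<le> 1" "z = (1 - a) *\<^sub>R x + a *\<^sub>R y"
        using z by (auto simp: in_segment)
      obtain b where b: "0 \<le> b" "b \<le> 1" "p = (1 - b) *\<^sub>R z + b *\<^sub>R y"
        using p(1) by (auto simp: in_segment)
      \<comment> \<open>If \<open>z\<close> has parameter \<open>a\<close> on the segment from
        \<open>x\<close> to \<open>y\<close>, and \<open>p\<close> has parameter \<open>b\<close> on
        the one from \<open>z\<close> to \<open>y\<close>, then \<open>p\<close> has parameter
        \<open>a + b * (1 - a)\<close>, at least \<open>a\<close>, on the former. So
        \<open>z\<close> lies between \<open>x\<close> and \<open>p\<close>.\<close>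
      have "z \<in> closed_segment x p"
      proof (cases "a + b * (1 - a) = 0")
        case True
        then have "a = 0" using a b by (smt (verit) mult_nonneg_nonneg)
        then show ?thesis using a by simp
      next
        case False
        define c where "c = a + b * (1 - a)"
        have c: "c > 0" "a \<le> c" using False a b unfolding c_def
          by (smt (verit) mult_nonneg_nonneg)+
        have pc: "p = (1 - c) *\<^sub>R x + c *\<^sub>R y"
          unfolding b(3) a(3) c_def by (simp add: algebra_simps)
        have "z = (1 - a/c) *\<^sub>R x + (a/c) *\<^sub>R p"
          unfolding pc a(3) using c(1) by (simp add: algebra_simps)
        then show ?thesis using c a by (auto simp: in_segment intro!: exI[of _ "a/c"])
      qed
      then have "z \<in> S"
        using cc[OF p(3)] \<open>x \<in> S\<close> p(2) by (meson closed_segment_subset subsetD)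
      then have "z \<in> frontier X" using fr p by auto
      with nz \<open>closed X\<close> show False by (metis closure_closed frontier_def Diff_iff)
    qed
  qed
  with r show "\<exists>r>0. \<forall>y\<in>X. dist x y < r \<longrightarrow> closed_segment x y \<subseteq> X" by blast
qed

lemma closed_convex_affine_image:
  fixes a v :: plane
  assumes "v \<noteq> 0" "closed T" "convex T"
  shows "closed ((\<lambda>s. a + s *\<^sub>R v) ` T)" "convex ((\<lambda>s. a + s *\<^sub>R v) ` T)"
proof -
  have eq: "(\<lambda>s. a + s *\<^sub>R v) ` T = (+) a ` (\<lambda>s. s *\<^sub>R v) ` T" by auto
  have lin: "linear (\<lambda>s::real. s *\<^sub>R v)" by (simp add: linear_iff scaleR_add_left)
  have "closed ((\<lambda>s. s *\<^sub>R v) ` T)"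
    using assms by (intro closed_injective_linear_image lin) (auto simp: inj_on_def)
  then show "closed ((\<lambda>s. a + s *\<^sub>R v) ` T)" unfolding eq by (rule closed_translation)
  show "convex ((\<lambda>s. a + s *\<^sub>R v) ` T)"
    unfolding eq using assms lin by (intro convex_translation convex_linear_image)
qed

lemma polygonal_imp_locally_star_shaped:
  assumes "polygonal_region X"
  shows "locally_star_shaped X"
proof -
  obtain \<L> where L: "closed X" "finite \<L>" "\<And>S. S\<in>\<L> \<Longrightarrow> is_segment S \<or> is_ray S \<or> is_line S"
      "frontier X = \<Union>\<L>"
    using assms unfolding polygonal_region_def frontier_complement by auto
  have "closed S \<and> convex S" if "S \<in> \<L>" for S
    using L(3)[OF that]
  proof (elim disjE)
    assume "is_segment S" then show ?thesis unfolding is_segment_def by auto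
  next
    assume "is_ray S"
    then obtain a v where "v \<noteq> 0" and S: "S = (\<lambda>s. a + s *\<^sub>R v) ` {0..}"
      unfolding is_ray_def by auto
    then show ?thesis using closed_convex_affine_image[of v "{0..}" a] by simp
  next
    assume "is_line S"
    then obtain a v where "v \<noteq> 0" and S: "S = (\<lambda>s. a + s *\<^sub>R v) ` UNIV"
      unfolding is_line_def by auto
    then show ?thesis using closed_convex_affine_image[of v UNIV a] by simp
  qed
  with L show ?thesis by (intro closed_convex_imp_locally_star_shaped)
qed

section \<open>Gradients of functions that are short along segments\<close>

text \<open>The chain rule along a segment issuing from \<open>x\<close>. The segment need not
  extend beyond \<open>x\<close>, so the limit is one-sided.\<close>

lemma has_gradient_within_directional:
  assumes g: "has_gradient_within f g S x" and seg: "closed_segment x z \<subseteq> S"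
  shows "((\<lambda>s. (f (x + s *\<^sub>R (z - x)) - f x) / s) \<longlongrightarrow> (z - x) \<bullet> g) (at_right 0)"
proof -
  have f: "(f has_derivative (\<lambda>h. h \<bullet> g)) (at x within S)"
    using g unfolding has_gradient_within_def by blast
  define p where "p = (\<lambda>s::real. x + s *\<^sub>R (z - x))"
  have sub: "p ` {0..1} \<subseteq> S"
    using seg unfolding p_def closed_segment_image_interval by (auto simp: algebra_simps)
  have "(p has_derivative (\<lambda>s. s *\<^sub>R (z - x))) (at 0 within {0..1})"
    unfolding p_def by (auto intro!: derivative_eq_intros)
  moreover have "(f has_derivative (\<lambda>h. h \<bullet> g)) (at (p 0) within p ` {0..1})"
    using has_derivative_subset[OF f sub] by (simp add: p_def)
  ultimately have "((\<lambda>s. f (p s)) has_derivative (\<lambda>s. (s *\<^sub>R (z - x)) \<bullet> g)) (at 0 within {0..1})"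
    by (rule has_derivative_in_compose)
  then have "((\<lambda>s. f (p s)) has_real_derivative (z - x) \<bullet> g) (at 0 within {0..1})"
    unfolding has_field_derivative_def by (simp add: mult_commute_abs)
  then have "((\<lambda>s. f (p s)) has_real_derivative (z - x) \<bullet> g) (at_right 0)"
    using at_within_Icc_at_right[of 0 "1::real"] by simp
  then show ?thesis
    unfolding has_field_derivative_iff by (simp add: p_def)
qed

text \<open>Near \<open>x\<close> there is a ball of interior points inside the star-shapedness
  radius. The cone over it with apex \<open>x\<close> lies in \<open>S\<close>, and gradients at
  boundary points are tested on this cone.\<close>

lemma interior_cone:
  assumes star: "locally_star_shaped S" and x: "x \<in> S" "x \<in> closure (interior S)"
  shows "\<exists>\<rho>>0. \<exists>k. \<forall>z\<in>ball k \<rho>. closed_segment x z \<subseteq> S"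
proof -
  obtain r where r: "r > 0" "\<And>y. y \<in> S \<Longrightarrow> dist x y < r \<Longrightarrow> closed_segment x y \<subseteq> S"
    using locally_star_shapedE[OF star x(1)] by blast
  have "interior S \<inter> ball x r \<noteq> {}"
    using x(2) r(1) by (metis centre_in_ball closure_iff_nhds_not_empty inf_commute open_ball subset_refl)
  then obtain k where "k \<in> interior S \<inter> ball x r" by blast
  moreover have "open (interior S \<inter> ball x r)" by auto
  ultimately obtain \<rho> where \<rho>: "\<rho> > 0" "ball k \<rho> \<subseteq> interior S \<inter> ball x r"
    by (meson open_contains_ball)
  have "closed_segment x z \<subseteq> S" if "z \<in> ball k \<rho>" for z
    using r(2)[of z] \<rho>(2) that interior_subset by fastforce
  with \<rho>(1) show ?thesis by blast
qed

text \<open>Both gradients give the same directional derivatives towards a whole ball of points, and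
  differences of such directions point everywhere. This makes the \<open>THE\<close> in
  \<open>grad2_dL\<close> meaningful.\<close>

lemma has_gradient_within_unique:
  assumes star: "locally_star_shaped S"
    and g: "has_gradient_within f g S x" and g': "has_gradient_within f g' S x"
  shows "g = g'"
proof -
  have x: "x \<in> S" "x \<in> closure (interior S)" using g unfolding has_gradient_within_def by auto
  obtain \<rho> k where \<rho>: "\<rho> > 0" "\<And>z. z \<in> ball k \<rho> \<Longrightarrow> closed_segment x z \<subseteq> S"
    using interior_cone[OF star x] by blast
  have eq: "(z - x) \<bullet> g = (z - x) \<bullet> g'" if "z \<in> ball k \<rho>" for z
    using has_gradient_within_directional[OF g \<rho>(2)[OF that]]
      has_gradient_within_directional[OF g' \<rho>(2)[OF that]]
    by (rule tendsto_unique[rotated]) simp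
  have "w \<bullet> (g - g') = 0" for w
  proof (cases "w = 0")
    case False
    define e where "e = \<rho> / (2 * norm w)"
    have "e > 0" using False \<rho> by (simp add: e_def)
    have "k + e *\<^sub>R w \<in> ball k \<rho>" using False \<rho> by (simp add: e_def dist_norm)
    have "k \<in> ball k \<rho>" using \<rho> by simp
    from eq[OF this] eq[OF \<open>k + e *\<^sub>R w \<in> ball k \<rho>\<close>]
    have "e * (w \<bullet> g) = e * (w \<bullet> g')"
      unfolding inner_add_left inner_diff_left inner_scaleR_left by linarith
    with \<open>e > 0\<close> show ?thesis by (simp add: inner_diff_right)
  qed simp
  from this[of "g - g'"] show ?thesis by simp
qed

text \<open>Even if \<open>x\<close> is a boundary point, the whole gradient is bounded, not only its component
  in the directions of \<open>S\<close>: the blow-ups of \<open>f\<close> at \<open>x\<close> are short on a fixed ball and converge there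
  to the derivative.\<close>

lemma norm_gradient_le_1:
  assumes star: "locally_star_shaped S"
    and g: "has_gradient_within f g S x"
    and short: "\<And>y z. closed_segment y z \<subseteq> S \<Longrightarrow> \<bar>f y - f z\<bar> \<le> dist y z"
  shows "norm g \<le> 1"
proof -
  have x: "x \<in> S" "x \<in> closure (interior S)" using g unfolding has_gradient_within_def by auto
  obtain \<rho> k where \<rho>: "\<rho> > 0" "\<And>z. z \<in> ball k \<rho> \<Longrightarrow> closed_segment x z \<subseteq> S"
    using interior_cone[OF star x] by blast
  have key: "(z - z') \<bullet> g \<le> dist z z'" if z: "z \<in> ball k \<rho>" "z' \<in> ball k \<rho>" for z z'
  proof -
    let ?p = "\<lambda>z s. x + s *\<^sub>R (z - x)"
    have lim: "((\<lambda>s. (f (?p z s) - f x) / s - (f (?p z' s) - f x) / s)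
        \<longlongrightarrow> (z - x) \<bullet> g - (z' - x) \<bullet> g) (at_right 0)"
      by (intro tendsto_diff has_gradient_within_directional[OF g] \<rho>(2) z)
    have "(z - x) \<bullet> g - (z' - x) \<bullet> g \<le> dist z z'"
    proof (rule tendsto_upperbound[OF lim])
      show "\<forall>\<^sub>F s in at_right 0. (f (?p z s) - f x) / s - (f (?p z' s) - f x) / s \<le> dist z z'"
        unfolding eventually_at_right_field
      proof (intro exI[of _ 1] conjI allI impI)
        fix s :: real assume s: "s > 0" "s < 1"
        \<comment> \<open>This segment is the segment from \<open>z\<close> to \<open>z'\<close>
          contracted towards \<open>x\<close> by the factor \<open>s\<close>, so it stays in the
          cone.\<close>
        have "closed_segment (?p z s) (?p z' s) \<subseteq> S"
        proof
          fix q assume "q \<in> closed_segment (?p z s) (?p z' s)"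
          then obtain u where u: "0 \<le> u" "u \<le> 1" "q = (1 - u) *\<^sub>R ?p z s + u *\<^sub>R ?p z' s"
            by (auto simp: in_segment)
          define m where "m = (1 - u) *\<^sub>R z + u *\<^sub>R z'"
          have "m \<in> ball k \<rho>" using u z convex_ball[of k \<rho>]
            unfolding m_def by (intro convexD) auto
          moreover have "q = (1 - s) *\<^sub>R x + s *\<^sub>R m"
            unfolding u(3) m_def by (simp add: algebra_simps)
          then have "q \<in> closed_segment x m" unfolding in_segment using s by (intro exI[of _ s]) simp
          ultimately show "q \<in> S" using \<rho>(2) by blast
        qed
        then have "f (?p z s) - f (?p z' s) \<le> dist (?p z s) (?p z' s)"
          using short by (meson abs_le_D1)
        also have "?p z s - ?p z' s = s *\<^sub>R (z - z')" by (simp add: algebra_simps)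
        then have "dist (?p z s) (?p z' s) = s * dist z z'" using s by (simp only: dist_norm norm_scaleR)
        finally have "(f (?p z s) - f (?p z' s)) / s \<le> dist z z'"
          using s by (simp add: divide_simps mult.commute)
        then show "(f (?p z s) - f x) / s - (f (?p z' s) - f x) / s \<le> dist z z'"
          by (simp add: diff_divide_distrib)
      qed simp
    qed simp
    then show ?thesis by (simp add: inner_diff_left)
  qed
  show ?thesis
  proof (cases "g = 0")
    case False
    \<comment> \<open>The direction tested is \<open>g\<close> itself; \<open>e\<close> makes the
      shift of \<open>k\<close> have norm \<rho>/2, so that it stays in the ball.\<close>
    define e where "e = \<rho> / (2 * norm g)"
    have e: "e > 0" using False \<rho> by (simp add: e_def)
    have "k + e *\<^sub>R g \<in> ball k \<rho>" "k \<in> ball k \<rho>" using False \<rho> by (simp_all add: e_def dist_norm)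
    from key[OF this] e have "e * (g \<bullet> g) \<le> e * norm g" by (simp add: dist_norm)
    with e have "norm g * norm g \<le> norm g" by (simp add: power2_norm_eq_inner[symmetric] power2_eq_square)
    with False show ?thesis by simp
  qed simp
qed

lemma grad2_dL_eqI:
  assumes "locally_star_shaped X" "has_gradient_within (\<lambda>y. dL X x1 y) g X x2"
  shows "grad2_dL X x1 x2 = g"
  unfolding grad2_dL_def using assms has_gradient_within_unique by blast

section \<open>Polygonal chains\<close>

text \<open>Chains replace curves because they can be followed by explicit piecewise constant
  controls. The length is an index of the relation, since two points are joined by many
  chains.\<close>

inductive poly_chain :: "'a::real_normed_vector set \<Rightarrow> 'a \<Rightarrow> 'a \<Rightarrow> real \<Rightarrow> bool" for X where
  refl: "x \<in> X \<Longrightarrow> poly_chain X x x 0"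
| step: "closed_segment x y \<subseteq> X \<Longrightarrow> poly_chain X y z l \<Longrightarrow> poly_chain X x z (dist x y + l)"

lemma poly_chain_ge_dist: "poly_chain X x y l \<Longrightarrow> dist x y \<le> l"
proof (induction rule: poly_chain.induct)
  case (step x y z l) then show ?case using dist_triangle[of x z y] by simp
qed simp

lemma poly_chain_nonneg: "poly_chain X x y l \<Longrightarrow> 0 \<le> l"
  using poly_chain_ge_dist zero_le_dist order_trans by blast

lemma poly_chain_trans: "poly_chain X x y l \<Longrightarrow> poly_chain X y z m \<Longrightarrow> poly_chain X x z (l + m)"
  by (induction rule: poly_chain.induct) (auto simp: add.assoc intro: poly_chain.step)

lemma poly_chain_segment: "closed_segment x y \<subseteq> X \<Longrightarrow> poly_chain X x y (dist x y)"
  using poly_chain.step[of x y X y 0] poly_chain.refl[of y X] by auto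

lemma poly_chain_sym: "poly_chain X x y l \<Longrightarrow> poly_chain X y x l"
proof (induction rule: poly_chain.induct)
  case (step x y z l)
  then show ?case
    using poly_chain_trans[OF step.IH poly_chain_segment[of y x X]]
    by (simp add: closed_segment_commute dist_commute add.commute)
qed (rule poly_chain.refl)

text \<open>Being joined by a chain is an equivalence relation whose classes are relatively open by
  star-shapedness; a connected set has only one such class.\<close>

lemma poly_chain_exists:
  assumes "connected X" "locally_star_shaped X" "x \<in> X" "y \<in> X"
  shows "\<exists>l. poly_chain X x y l"
proof (rule connected_equivalence_relation[OF assms(1,3,4)])
  fix a assume a: "a \<in> X"
  then obtain r where r: "r > 0" "\<And>y. y \<in> X \<Longrightarrow> dist a y < r \<Longrightarrow> closed_segment a y \<subseteq> X"
    using locally_star_shapedE[OF assms(2)] by blast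
  then have "\<forall>x\<in>X \<inter> ball a r. \<exists>l. poly_chain X a x l"
    using poly_chain_segment by (metis IntE mem_ball)
  then show "\<exists>T. openin (top_of_set X) T \<and> a \<in> T \<and> (\<forall>x\<in>T. \<exists>l. poly_chain X a x l)"
    using a r(1) by (intro exI[of _ "X \<inter> ball a r"]) auto
qed (blast intro: poly_chain_sym poly_chain_trans)+

section \<open>Replacing curves by chains that are not longer\<close>

lemma vector_derivative_speed_bound:
  fixes g :: "real \<Rightarrow> plane"
  assumes g: "valid_path g"
    and int: "(\<lambda>t. norm (vector_derivative g (at t))) integrable_on {0..1}"
    and st: "0 \<le> s" "s \<le> t" "t \<le> 1"
  shows "dist (g s) (g t) \<le> integral {s..t} (\<lambda>t. norm (vector_derivative g (at t)))"
proof -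
  obtain D where D: "finite D" "g C1_differentiable_on ({0..1} - D)" and cont: "continuous_on {0..1} g"
    using g unfolding valid_path_def piecewise_C1_differentiable_on_def by blast
  have "((\<lambda>t. vector_derivative g (at t)) has_integral g t - g s) {s..t}"
  proof (rule fundamental_theorem_of_calculus_interior_strong[OF D(1) st(2)])
    show "continuous_on {s..t} g" using continuous_on_subset[OF cont] st by auto
    fix x assume "x \<in> {s<..<t} - D"
    then have "x \<in> {0..1} - D" using st by auto
    then have "g differentiable at x" using D(2) unfolding C1_differentiable_on_eq by blast
    then show "(g has_vector_derivative vector_derivative g (at x)) (at x)"
      by (simp add: vector_derivative_works)
  qed
  moreover have "(\<lambda>t. norm (vector_derivative g (at t))) integrable_on {s..t}"
    using integrable_on_subinterval[OF int] st by auto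
  ultimately have "norm (g t - g s) \<le> integral {s..t} (\<lambda>t. norm (vector_derivative g (at t)))"
    by (metis (mono_tags, lifting) has_integral_iff Henstock_Kurzweil_Integration.integral_norm_bound_integral order_refl)
  then show ?thesis by (simp add: dist_norm norm_minus_commute)
qed

text \<open>Near each time \<open>t\<close> the curve may be replaced by two chords through
  \<open>g t\<close>, which are no longer than the arc. Bisection glues these local chains
  together.\<close>

lemma poly_chain_below_curve:
  assumes star: "locally_star_shaped X" and l: "l \<in> curve_lengths X x y"
  shows "\<exists>l'\<le>l. poly_chain X x y l'"
proof -
  obtain g where g: "valid_path g" "path_image g \<subseteq> X" "pathstart g = x" "pathfinish g = y"
     and len: "((\<lambda>t. norm (vector_derivative g (at t))) has_integral l) {0..1}"
    using l unfolding curve_lengths_def by blast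
  let ?n = "\<lambda>t. norm (vector_derivative g (at t))"
  have int: "?n integrable_on {0..1}" using len by blast
  have cont: "continuous_on {0..1} g"
    using g(1) unfolding valid_path_def piecewise_C1_differentiable_on_def by blast
  have inX: "g t \<in> X" if "0 \<le> t" "t \<le> 1" for t
    using g(2) that unfolding path_image_def by auto
  \<comment> \<open>The guards make \<open>P\<close> trivial for intervals sticking out of
    \<open>{0..1}\<close>, which occur in the local condition of \<open>Bolzano\<close>.\<close>
  define P where "P = (\<lambda>s t. 0 \<le> s \<longrightarrow> t \<le> 1 \<longrightarrow>
      (\<exists>l'\<le>integral {s..t} ?n. poly_chain X (g s) (g t) l'))"
  have "P 0 1"
    using zero_le_one
  proof (induction rule: Bolzano)
    case (trans a b c)
    show ?case unfolding P_def
    proof (intro impI)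
      assume ac: "0 \<le> a" "c \<le> 1"
      obtain l1 l2 where l1: "l1 \<le> integral {a..b} ?n" "poly_chain X (g a) (g b) l1"
        and l2: "l2 \<le> integral {b..c} ?n" "poly_chain X (g b) (g c) l2"
        using trans ac unfolding P_def by fastforce
      have "integral {a..b} ?n + integral {b..c} ?n = integral {a..c} ?n"
        using trans ac by (intro Henstock_Kurzweil_Integration.integral_combine
            integrable_on_subinterval[OF int]) auto
      then show "\<exists>l'\<le>integral {a..c} ?n. poly_chain X (g a) (g c) l'"
        using poly_chain_trans[OF l1(2) l2(2)] l1 l2 by (intro exI[of _ "l1 + l2"]) auto
    qed
  next
    case (local t)
    obtain r where r: "r > 0" "\<And>y. y \<in> X \<Longrightarrow> dist (g t) y < r \<Longrightarrow> closed_segment (g t) y \<subseteq> X"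
      using locally_star_shapedE[OF star] inX local by metis
    obtain d where d: "d > 0" "\<And>s. s \<in> {0..1} \<Longrightarrow> dist s t < d \<Longrightarrow> dist (g s) (g t) < r"
      using cont local r(1) unfolding continuous_on_iff by (metis atLeastAtMost_iff)
    have seg: "poly_chain X (g t) (g s) (dist (g t) (g s))" if "0 \<le> s" "s \<le> 1" "dist s t < d" for s
      using that inX r(2) d(2) by (intro poly_chain_segment) (auto simp: dist_commute)
    have "P a b" if ab: "a \<le> t" "t \<le> b" "b - a < d" for a b
      unfolding P_def
    proof (intro impI)
      assume b: "0 \<le> a" "b \<le> 1"
      \<comment> \<open>The detour through \<open>g t\<close>, the centre of the star, is needed
        because the direct segment from \<open>g a\<close> to \<open>g b\<close> may leave
        \<open>X\<close>.\<close>
      have "poly_chain X (g a) (g b) (dist (g t) (g a) + dist (g t) (g b))"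
        using ab b by (intro poly_chain_trans[OF poly_chain_sym[OF seg] seg]) (auto simp: dist_real_def)
      moreover have "dist (g a) (g t) \<le> integral {a..t} ?n" "dist (g t) (g b) \<le> integral {t..b} ?n"
        using ab b vector_derivative_speed_bound[OF g(1) int] by auto
      moreover have "integral {a..t} ?n + integral {t..b} ?n = integral {a..b} ?n"
        using ab b by (intro Henstock_Kurzweil_Integration.integral_combine
            integrable_on_subinterval[OF int]) auto
      ultimately show "\<exists>l'\<le>integral {a..b} ?n. poly_chain X (g a) (g b) l'"
        by (intro exI[of _ "dist (g t) (g a) + dist (g t) (g b)"]) (auto simp: dist_commute)
    qed
    with d(1) show ?case by blast
  qed
  then show ?thesis
    using g(3,4) len unfolding P_def pathstart_def pathfinish_def by (auto simp: integral_unique)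
qed

section \<open>Controls and trajectories\<close>

lemma controls_norm: "u \<in> controls t0 \<Longrightarrow> t0 \<le> t \<Longrightarrow> norm (u t) = 1"
  unfolding controls_def by (auto simp: PiE_def Pi_def)

lemma controls_discontinuities:
  "u \<in> controls t0 \<Longrightarrow> finite {t \<in> {t0..T}. \<not> continuous (at t within {t0..}) u}"
  unfolding controls_def piecewise_continuous_from_def by blast

text \<open>Off its finitely many discontinuities in the interval \<open>u\<close> is continuous,
  hence measurable, and of norm 1; finitely many points do not affect integrability.\<close>

lemma controls_integrable:
  assumes u: "u \<in> controls t0" and a: "t0 \<le> a"
  shows "u integrable_on {a..b}"
proof -
  define D where "D = {t \<in> {t0..b}. \<not> continuous (at t within {t0..}) u}"
  have D: "finite D" unfolding D_def using u by (rule controls_discontinuities)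
  have sets: "{a..b} - D \<in> sets lebesgue" 
    using sets.Diff[OF _ negligible_imp_sets[OF negligible_finite[OF D]]] by simp
  have "continuous_on ({a..b} - D) u"
    unfolding continuous_on_eq_continuous_within
  proof
    fix t assume "t \<in> {a..b} - D"
    then have "continuous (at t within {t0..}) u" using a by (auto simp: D_def)
    then show "continuous (at t within {a..b} - D) u"
      by (rule continuous_within_subset) (use a in auto)
  qed
  then have "u \<in> borel_measurable (lebesgue_on ({a..b} - D))"
    using sets by (rule continuous_imp_measurable_on_sets_lebesgue)
  moreover have "(\<lambda>t. 1::real) integrable_on {a..b} - D"
    by (rule integrable_spike_set[of _ "{a..b}"])
      (use D in \<open>auto intro: negligible_subset[OF negligible_finite]\<close>)
  ultimately have "u integrable_on {a..b} - D"
    by (rule measurable_bounded_by_integrable_imp_integrable)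
      (use sets controls_norm[OF u] a in auto)
  then show ?thesis
    by (rule integrable_spike_set) (use D in \<open>auto intro: negligible_subset[OF negligible_finite]\<close>)
qed

lemma trajectory_initial [simp]: "trajectory s t0 x0 u t0 = x0"
  by (simp add: trajectory_def)

lemma trajectory_diff:
  assumes "u \<in> controls t0" "t0 \<le> a" "a \<le> b"
  shows "trajectory s t0 x0 u b - trajectory s t0 x0 u a = s *\<^sub>R integral {a..b} u"
  using Henstock_Kurzweil_Integration.integral_combine[OF assms(2,3) controls_integrable[OF assms(1) order_refl]]
  unfolding trajectory_def by (simp add: scaleR_add_right[symmetric] flip: scaleR_diff_right) (metis add_diff_cancel_left')

lemma trajectory_dist_le:
  assumes "u \<in> controls t0" "t0 \<le> a" "a \<le> b" "0 \<le> s"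
  shows "dist (trajectory s t0 x0 u a) (trajectory s t0 x0 u b) \<le> s * (b - a)"
proof -
  have "norm (integral {a..b} u) \<le> integral {a..b} (\<lambda>t. 1::real)"
    using controls_integrable[OF assms(1,2)] controls_norm[OF assms(1)] assms(2)
    by (intro Henstock_Kurzweil_Integration.integral_norm_bound_integral) auto
  then have "norm (integral {a..b} u) \<le> b - a" using assms(3) by simp
  then have "norm (trajectory s t0 x0 u b - trajectory s t0 x0 u a) \<le> s * (b - a)"
    unfolding trajectory_diff[OF assms(1-3)] using assms(4) by (simp add: mult_left_mono)
  then show ?thesis by (simp add: dist_norm norm_minus_commute)
qed

lemma trajectory_has_vector_derivative:
  assumes u: "u \<in> controls t0" and t: "t0 < t" and cont: "isCont u t"
  shows "(trajectory s t0 x0 u has_vector_derivative s *\<^sub>R u t) (at t)"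
proof -
  have "((\<lambda>r. integral {t0..r} u) has_vector_derivative u t) (at t within ({t0..t + 1} - {}))"
    using t cont by (intro integral_has_vector_derivative_continuous_at controls_integrable[OF u])
      (auto intro: continuous_at_imp_continuous_at_within)
  then have "((\<lambda>r. integral {t0..r} u) has_vector_derivative u t) (at t)"
    using t at_within_interior[of t "{t0..t + 1}"] by simp
  then show ?thesis
    unfolding trajectory_def [abs_def]
    by (auto intro!: derivative_eq_intros)
qed

text \<open>Controls have norm 1, so a trajectory has constant speed \<open>s\<close>; rescaling
  time to \<open>{0..1}\<close> makes it a valid path. Hence motion of either player bounds
  \<open>dL\<close> from above.\<close>

lemma trajectory_curve_length:
  assumes u: "u \<in> admissible_controls X s t0 x0" and s: "0 \<le> s" and ab: "t0 \<le> a" "a \<le> b"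
  shows "s * (b - a) \<in> curve_lengths X (trajectory s t0 x0 u a) (trajectory s t0 x0 u b)"
proof -
  define p where "p = trajectory s t0 x0 u"
  have uc: "u \<in> controls t0" and inX: "\<And>t. t0 \<le> t \<Longrightarrow> p t \<in> X"
    using u unfolding admissible_controls_def p_def by auto
  define c where "c = (\<lambda>\<tau>::real. a + \<tau> * (b - a))"
  have c: "a \<le> c \<tau>" "c \<tau> \<le> b" if "0 \<le> \<tau>" "\<tau> \<le> 1" for \<tau>
    using that ab mult_left_le_one_le[of "b - a" \<tau>] by (auto simp: c_def)
  have "\<exists>g. valid_path g \<and> path_image g \<subseteq> X \<and> pathstart g = p a \<and> pathfinish g = p b \<and>
     ((\<lambda>t. norm (vector_derivative g (at t))) has_integral s * (b - a)) {0..1}"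
  proof (cases "a = b")
    case True
    then show ?thesis
      using inX ab has_integral_is_0[of "{0..1::real}" "\<lambda>_. 0::real"]
      by (intro exI[of _ "linepath (p a) (p a)"]) (auto simp: linepath_refl[symmetric])
  next
    case False
    then have less: "a < b" using ab by simp
    define E where "E = {t \<in> {t0..b}. \<not> continuous (at t within {t0..}) u}"
    \<comment> \<open>Exceptional times are the rescaled discontinuities of \<open>u\<close> and the
      endpoints; \<open>c 0 = a\<close> may be \<open>t0\<close>, where continuity of
      \<open>u\<close> is only one-sided.\<close>
    define D where "D = {0, 1} \<union> (\<lambda>t. (t - a) / (b - a)) ` E"
    have D: "finite D" unfolding D_def E_def using controls_discontinuities[OF uc] by simp
    have cont_u: "isCont u (c \<tau>)" and c0: "t0 < c \<tau>" if \<tau>: "\<tau> \<in> {0..1} - D" for \<tau>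
    proof -
      have \<tau>01: "0 < \<tau>" "\<tau> < 1" using \<tau> by (auto simp: D_def less_le)
      then show "t0 < c \<tau>" using less ab by (simp add: c_def add.commute add_pos_nonneg less_le_trans)
          (smt (verit) mult_pos_pos)
      moreover have "c \<tau> \<notin> E"
      proof
        assume "c \<tau> \<in> E"
        then have "(c \<tau> - a) / (b - a) \<in> D" unfolding D_def by blast
        then show False using \<tau> less by (simp add: c_def)
      qed
      ultimately have "continuous (at (c \<tau>) within {t0..}) u"
        using c[of \<tau>] \<tau> by (auto simp: E_def)
      then show "isCont u (c \<tau>)"
        using \<open>t0 < c \<tau>\<close> at_within_interior[of "c \<tau>" "{t0..}"] by (simp add: interior_real_atLeast)
    qed
    have der: "((p \<circ> c) has_vector_derivative (b - a) *\<^sub>R s *\<^sub>R u (c \<tau>)) (at \<tau>)"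
      if "\<tau> \<in> {0..1} - D" for \<tau>
    proof (rule vector_diff_chain_at)
      show "(c has_vector_derivative (b - a)) (at \<tau>)"
        unfolding c_def by (auto intro!: derivative_eq_intros simp: has_real_derivative_iff_has_vector_derivative[symmetric])
      show "(p has_vector_derivative s *\<^sub>R u (c \<tau>)) (at (c \<tau>))"
        unfolding p_def using that by (intro trajectory_has_vector_derivative uc cont_u c0)
    qed
    have contp: "continuous_on {a..b} p"
    proof -
      have "continuous_on {t0..b} p"
        unfolding p_def trajectory_def [abs_def]
        by (intro continuous_intros indefinite_integral_continuous_1 controls_integrable[OF uc order_refl])
      then show ?thesis by (rule continuous_on_subset) (use ab in auto)
    qed
    have "continuous_on {0..1} (p \<circ> c)"
    proof (rule continuous_on_compose)
      show "continuous_on {0..1} c" unfolding c_def by (intro continuous_intros)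
      show "continuous_on (c ` {0..1}) p" by (rule continuous_on_subset[OF contp]) (use c in auto)
    qed
    moreover have "continuous_on ({0..1} - D) (\<lambda>\<tau>. (b - a) *\<^sub>R s *\<^sub>R u (c \<tau>))"
    proof (intro continuous_at_imp_continuous_on ballI continuous_intros)
      fix \<tau> assume "\<tau> \<in> {0..1} - D"
      then have "isCont u (c \<tau>)" by (rule cont_u)
      moreover have "isCont c \<tau>" unfolding c_def by (intro continuous_intros)
      ultimately show "isCont (\<lambda>\<tau>. u (c \<tau>)) \<tau>" using isCont_o2[of \<tau> c u] by blast
    qed
    ultimately have "valid_path (p \<circ> c)"
      unfolding valid_path_def piecewise_C1_differentiable_on_def C1_differentiable_on_def
      using D by (intro conjI exI[of _ D] exI[of _ "\<lambda>\<tau>. (b - a) *\<^sub>R s *\<^sub>R u (c \<tau>)"] ballI der)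
    moreover have "path_image (p \<circ> c) \<subseteq> X"
      unfolding path_image_def using inX order_trans[OF ab(1) c(1)] by auto
    moreover have "pathstart (p \<circ> c) = p a" "pathfinish (p \<circ> c) = p b"
      by (auto simp: pathstart_def pathfinish_def c_def)
    moreover have "((\<lambda>t. norm (vector_derivative (p \<circ> c) (at t))) has_integral s * (b - a)) {0..1}"
    proof (rule has_integral_spike_finite[OF D])
      show "((\<lambda>_. s * (b - a)) has_integral s * (b - a)) {0..1::real}"
        using has_integral_const_real[of "s * (b - a)" 0 1] by simp
      fix \<tau> assume \<tau>: "\<tau> \<in> {0..1} - D"
      show "norm (vector_derivative (p \<circ> c) (at \<tau>)) = s * (b - a)"
        using vector_derivative_at[OF der[OF \<tau>]] controls_norm[OF uc, of "c \<tau>"] c0[OF \<tau>] s less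
        by (simp add: abs_mult)
    qed
    ultimately show ?thesis by blast
  qed
  then show ?thesis unfolding curve_lengths_def p_def by blast
qed

section \<open>Concatenation of controls\<close>

text \<open>Before \<open>t0\<close> the result inherits from \<open>u\<close> the default value
  \<open>undefined\<close> that \<open>controls t0\<close> demands.\<close>

definition switch_control :: "real \<Rightarrow> (real \<Rightarrow> plane) \<Rightarrow> (real \<Rightarrow> plane) \<Rightarrow> real \<Rightarrow> plane" where
  "switch_control T u v t = (if t < T then u t else v t)"

text \<open>Away from \<open>T\<close> the switched control agrees locally with \<open>u\<close> or
  with \<open>v\<close>; at \<open>T\<close> it has the left limit of \<open>u\<close> and the right
  limit of \<open>v\<close>. Only \<open>T\<close> can become a new discontinuity.\<close>

lemma switch_control_in_controls:
  assumes T: "t0 \<le> T" and u: "u \<in> controls t0" and v: "v \<in> controls T"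
  shows "switch_control T u v \<in> controls t0"
proof -
  let ?w = "switch_control T u v"
  have before: "\<forall>\<^sub>F r in nhds t. ?w r = u r" if "t < T" for t
    using eventually_nhds_in_open[of "{..<T}" t] that
    by (auto simp: switch_control_def elim!: eventually_mono)
  have after: "\<forall>\<^sub>F r in nhds t. ?w r = v r" if "T < t" for t
    using eventually_nhds_in_open[of "{T<..}" t] that
    by (auto simp: switch_control_def elim!: eventually_mono)
  have pu: "piecewise_continuous_from t0 u" and pv: "piecewise_continuous_from T v"
    and ue: "u \<in> {t0..} \<rightarrow>\<^sub>E sphere 0 1" and ve: "v \<in> {T..} \<rightarrow>\<^sub>E sphere 0 1"
    using u v unfolding controls_def by auto
  have "?w \<in> {t0..} \<rightarrow>\<^sub>E sphere 0 1"
    using ue ve T by (auto simp: switch_control_def PiE_def Pi_def extensional_def)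
  moreover have "piecewise_continuous_from t0 ?w"
    unfolding piecewise_continuous_from_def
  proof (intro conjI allI impI)
    fix T'
    have "{t \<in> {t0..T'}. \<not> continuous (at t within {t0..}) ?w} \<subseteq>
       {t \<in> {t0..T'}. \<not> continuous (at t within {t0..}) u} \<union>
       {t \<in> {T..T'}. \<not> continuous (at t within {T..}) v} \<union> {T}" (is "_ \<subseteq> ?R")
    proof
      fix t assume t: "t \<in> {t \<in> {t0..T'}. \<not> continuous (at t within {t0..}) ?w}"
      show "t \<in> ?R"
      proof (cases t T rule: linorder_cases)
        case less
        have "continuous (at t within {t0..}) ?w = continuous (at t within {t0..}) u"
        proof -
          have "?w t = u t" using less by (simp add: switch_control_def)
          moreover have "\<forall>\<^sub>F r in at t within {t0..}. ?w r = u r"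
            using before[OF less] by (simp add: eventually_at_filter eventually_mono)
          ultimately show ?thesis unfolding continuous_within by (simp only: tendsto_cong)
        qed
        with t show ?thesis by auto
      next
        case greater
        have "at t within {T..} = at t" "at t within {t0..} = at t"
          using greater T by (auto intro!: at_within_interior simp: interior_real_atLeast)
        moreover have "isCont ?w t = isCont v t"
          using after[OF greater] by (rule isCont_cong)
        ultimately show ?thesis using t greater by auto
      qed simp
    qed
    moreover have "finite ?R"
      using pu pv unfolding piecewise_continuous_from_def by blast
    ultimately show "finite {t \<in> {t0..T'}. \<not> continuous (at t within {t0..}) ?w}"
      by (rule finite_subset)
  next
    fix t assume t: "t0 \<le> t"
    show "\<exists>l. (?w \<longlongrightarrow> l) (at_right t)"
    proof (cases "t < T")
      case True
      have "\<forall>\<^sub>F r in at_right t. ?w r = u r"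
        using before[OF True] by (rule filter_leD[rotated]) (simp add: at_within_def)
      moreover obtain l where "(u \<longlongrightarrow> l) (at_right t)"
        using pu t unfolding piecewise_continuous_from_def by blast
      ultimately show ?thesis using tendsto_cong by blast
    next
      case False
      have "\<forall>\<^sub>F r in at_right t. ?w r = v r"
        using eventually_at_right_less[of t] False by (auto simp: switch_control_def elim!: eventually_mono)
      moreover obtain l where "(v \<longlongrightarrow> l) (at_right t)"
        using pv False unfolding piecewise_continuous_from_def by (meson not_less)
      ultimately show ?thesis using tendsto_cong by blast
    qed
  next
    fix t assume t: "t0 < t"
    show "\<exists>l. (?w \<longlongrightarrow> l) (at_left t)"
    proof (cases "t \<le> T")
      case True
      have "\<forall>\<^sub>F r in at_left t. ?w r = u r"
        using True by (auto simp: switch_control_def eventually_at_filter)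
      moreover obtain l where "(u \<longlongrightarrow> l) (at_left t)"
        using pu t unfolding piecewise_continuous_from_def by blast
      ultimately show ?thesis using tendsto_cong by blast
    next
      case False
      then have "\<forall>\<^sub>F r in at_left t. ?w r = v r"
        using after[of t] by (intro filter_leD[of "at_left t" "nhds t"]) (auto simp: at_within_def)
      moreover obtain l where "(v \<longlongrightarrow> l) (at_left t)"
        using pv False unfolding piecewise_continuous_from_def by (meson not_less)
      ultimately show ?thesis using tendsto_cong by blast
    qed
  qed
  ultimately show ?thesis unfolding controls_def by blast
qed

lemma trajectory_switch_before:
  "t \<le> T \<Longrightarrow> trajectory s t0 x0 (switch_control T u v) t = trajectory s t0 x0 u t"
  unfolding trajectory_def
  by (subst integral_spike[of "{T}" "{t0..t}" "switch_control T u v" u])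
    (auto simp: switch_control_def)

lemma trajectory_switch_after:
  assumes T: "t0 \<le> T" "T \<le> t" and u: "u \<in> controls t0" and v: "v \<in> controls T"
  shows "trajectory s t0 x0 (switch_control T u v) t
    = trajectory s T (trajectory s t0 x0 u T) v t"
proof -
  have "trajectory s t0 x0 (switch_control T u v) t
    = trajectory s t0 x0 (switch_control T u v) T + s *\<^sub>R integral {T..t} (switch_control T u v)"
    using trajectory_diff[OF switch_control_in_controls[OF T(1) u v] T] by (metis add.commute diff_add_cancel)
  also have "integral {T..t} (switch_control T u v) = integral {T..t} v"
    by (rule integral_cong) (auto simp: switch_control_def)
  finally show ?thesis by (simp add: trajectory_switch_before) (simp add: trajectory_def)
qed

text \<open>Only the part of \<open>u\<close> up to \<open>T\<close> has to stay in
  \<open>X\<close>: a straight motion along one segment of a chain may leave \<open>X\<close> if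
  continued.\<close>

lemma switch_control_admissible:
  assumes T: "t0 \<le> T" and u: "u \<in> controls t0" "\<And>t. t \<in> {t0..T} \<Longrightarrow> trajectory s t0 x0 u t \<in> X"
    and v: "v \<in> admissible_controls X s T (trajectory s t0 x0 u T)"
  shows "switch_control T u v \<in> admissible_controls X s t0 x0"
proof -
  have vc: "v \<in> controls T" using v by (simp add: admissible_controls_def)
  have "trajectory s t0 x0 (switch_control T u v) t \<in> X" if "t0 \<le> t" for t
  proof (cases "t \<le> T")
    case True
    then show ?thesis using that u(2) by (simp add: trajectory_switch_before)
  next
    case False
    then show ?thesis using v T by (simp add: trajectory_switch_after[OF T _ u(1) vc] admissible_controls_def)
  qed
  then show ?thesis using switch_control_in_controls[OF T u(1) vc] by (simp add: admissible_controls_def)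
qed

lemma admissible_switch_control:
  assumes "t0 \<le> T" "u \<in> admissible_controls X s t0 x0"
    and "v \<in> admissible_controls X s T (trajectory s t0 x0 u T)"
  shows "switch_control T u v \<in> admissible_controls X s t0 x0"
  using assms by (intro switch_control_admissible) (auto simp: admissible_controls_def)

section \<open>Motion along a segment\<close>

text \<open>Between an endpoint and the nearest discontinuity the function is continuous with finite
  range on a connected set, hence constant. This yields the one-sided limits of a sign
  function.\<close>

lemma finite_range_one_sided_constant:
  fixes \<sigma> :: "real \<Rightarrow> real"
  assumes lr: "l < r" and fin: "finite {x \<in> {l<..<r}. \<not> isCont \<sigma> x}" and ran: "finite (range \<sigma>)"
  shows "\<exists>c. \<forall>\<^sub>F x in at_right l. \<sigma> x = c" and "\<exists>c. \<forall>\<^sub>F x in at_left r. \<sigma> x = c"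
proof -
  define D where "D = {x \<in> {l<..<r}. \<not> isCont \<sigma> x}"
  have const: "\<exists>c. \<forall>x\<in>{a<..<b}. \<sigma> x = c" if "\<And>x. x \<in> {a<..<b} \<Longrightarrow> isCont \<sigma> x" for a b
  proof -
    have "\<sigma> constant_on {a<..<b}"
      by (intro continuous_finite_range_constant continuous_at_imp_continuous_on ballI that)
        (auto intro: finite_subset[OF _ ran])
    then show ?thesis by (auto simp: constant_on_def)
  qed
  have D: "finite D" using fin by (simp add: D_def)
  define m where "m = Min (insert r D)"
  have "l < m" unfolding m_def using D lr by (subst Min_gr_iff) (auto simp: D_def)
  moreover have "isCont \<sigma> x" if x: "x \<in> {l<..<m}" for x
  proof -
    have "x < r \<and> x \<notin> D" using x D unfolding m_def by (auto simp: Min_gr_iff)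
    then show ?thesis using x by (auto simp: D_def)
  qed
  ultimately show "\<exists>c. \<forall>\<^sub>F x in at_right l. \<sigma> x = c"
    using const[of l m] unfolding eventually_at_right_field by fastforce
  define m' where "m' = Max (insert l D)"
  have "m' < r" unfolding m'_def using D lr by (subst Max_less_iff) (auto simp: D_def)
  moreover have "isCont \<sigma> x" if x: "x \<in> {m'<..<r}" for x
  proof -
    have "l < x \<and> x \<notin> D" using x D unfolding m'_def by (auto simp: Max_less_iff)
    then show ?thesis using x by (auto simp: D_def)
  qed
  ultimately show "\<exists>c. \<forall>\<^sub>F x in at_left r. \<sigma> x = c"
    using const[of m' r] unfolding eventually_at_left_field by fastforce
qed

text \<open>Serves both straight motion, with \<sigma> constant, and motion back and forth along
  \<open>e\<close>.\<close>

lemma sign_control_in_controls: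
  fixes \<sigma> :: "real \<Rightarrow> real" and e :: plane
  assumes e: "norm e = 1" and ran: "range \<sigma> \<subseteq> {1, -1}"
    and fin: "\<And>T. finite {t \<in> {t0..T}. \<not> isCont \<sigma> t}"
  shows "(\<lambda>t\<in>{t0..}. \<sigma> t *\<^sub>R e) \<in> controls t0"
proof -
  let ?u = "\<lambda>t\<in>{t0..}. \<sigma> t *\<^sub>R e"
  have "\<bar>\<sigma> t\<bar> = 1" for t using subsetD[OF ran rangeI[of \<sigma> t]] by auto
  then have "norm (?u t) = 1" if "t0 \<le> t" for t using that e by simp
  then have "?u \<in> {t0..} \<rightarrow>\<^sub>E sphere 0 1" by (intro PiE_I) auto
  moreover have "piecewise_continuous_from t0 ?u"
    unfolding piecewise_continuous_from_def
  proof (intro conjI allI impI)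
    fix T
    have "continuous (at t within {t0..}) ?u" if "isCont \<sigma> t" "t0 \<le> t" for t
    proof -
      have "isCont (\<lambda>t. \<sigma> t *\<^sub>R e) t" using that(1) by (intro continuous_intros)
      then have "continuous (at t within {t0..}) (\<lambda>t. \<sigma> t *\<^sub>R e)"
        by (rule continuous_at_imp_continuous_at_within)
      then show ?thesis
        by (rule continuous_transform_within[where \<delta> = 1]) (use that in auto)
    qed
    then show "finite {t \<in> {t0..T}. \<not> continuous (at t within {t0..}) ?u}"
      by (intro finite_subset[OF _ fin[of T]]) auto
  next
    fix t assume t: "t0 \<le> t"
    have "finite {x \<in> {t<..<t+1}. \<not> isCont \<sigma> x}"
      by (rule finite_subset[OF _ fin[of "t+1"]]) (use t in auto)
    then obtain c where "\<forall>\<^sub>F x in at_right t. \<sigma> x = c"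
      using finite_range_one_sided_constant(1)[of t "t+1" \<sigma>] finite_subset[OF ran] by auto
    then have "\<forall>\<^sub>F x in at_right t. ?u x = c *\<^sub>R e"
      using eventually_at_right_less[of t] by eventually_elim (use t in auto)
    then show "\<exists>l. (?u \<longlongrightarrow> l) (at_right t)" using tendsto_eventually by blast
  next
    fix t assume t: "t0 < t"
    have "finite {x \<in> {t0<..<t}. \<not> isCont \<sigma> x}"
      by (rule finite_subset[OF _ fin[of t]]) (use t in auto)
    then obtain c where "\<forall>\<^sub>F x in at_left t. \<sigma> x = c"
      using finite_range_one_sided_constant(2)[of t0 t \<sigma>] t finite_subset[OF ran] by auto
    moreover have "\<forall>\<^sub>F x in at_left t. t0 < x"
      using t unfolding eventually_at_left_field by blast
    ultimately have "\<forall>\<^sub>F x in at_left t. ?u x = c *\<^sub>R e"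
      by eventually_elim auto
    then show "\<exists>l. (?u \<longlongrightarrow> l) (at_left t)" using tendsto_eventually by blast
  qed
  ultimately show ?thesis unfolding controls_def by blast
qed

lemma unit_vector_towards:
  fixes y z :: plane
  assumes "y \<noteq> z"
  obtains e where "norm e = 1" "y = z + dist z y *\<^sub>R e"
    "\<And>r. 0 \<le> r \<Longrightarrow> r \<le> dist z y \<Longrightarrow> z + r *\<^sub>R e \<in> closed_segment z y"
proof (rule that[of "(y - z) /\<^sub>R dist z y"])
  have d: "dist z y > 0" using assms by simp
  then show "norm ((y - z) /\<^sub>R dist z y) = 1" by (simp add: dist_norm norm_minus_commute)
  show "y = z + dist z y *\<^sub>R ((y - z) /\<^sub>R dist z y)" using d by simp
  fix r assume r: "0 \<le> r" "r \<le> dist z y"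
  have "z + r *\<^sub>R ((y - z) /\<^sub>R dist z y) = (1 - r / dist z y) *\<^sub>R z + (r / dist z y) *\<^sub>R y"
    by (simp add: algebra_simps divide_inverse)
  then show "z + r *\<^sub>R ((y - z) /\<^sub>R dist z y) \<in> closed_segment z y"
    unfolding in_segment using r d by (intro exI[of _ "r / dist z y"]) auto
qed

text \<open>Controls never stop, so a player who has arrived keeps moving back and forth on a segment;
  \<open>arccos \<circ> cos\<close> is the triangle wave that describes the position.\<close>

lemma oscillating_control:
  fixes z y :: plane
  assumes zy: "y \<noteq> z" and seg: "closed_segment z y \<subseteq> X"
  shows "\<exists>u. u \<in> admissible_controls X 1 t0 z"
proof -
  obtain e where e: "norm e = 1" "\<And>r. 0 \<le> r \<Longrightarrow> r \<le> dist z y \<Longrightarrow> z + r *\<^sub>R e \<in> closed_segment z y"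
    using unit_vector_towards[OF zy] by metis
  \<comment> \<open>With this scaling each monotone stretch of the wave \<open>p\<close> below lasts
    \<open>dist z y\<close>, so the segment is traversed at speed 1.\<close>
  define k where "k = pi / dist z y"
  have k: "k > 0" "pi / k = dist z y" using zy by (auto simp: k_def)
  \<comment> \<open>The derivative of \<open>arccos (cos w)\<close> is the sign of
    \<open>sin w\<close>; the value chosen at the turning times, where the sine vanishes, is
    immaterial for the integral.\<close>
  define \<sigma> where "\<sigma> = (\<lambda>t. if sin (k * (t - t0)) \<ge> 0 then 1 else -1 :: real)"
  define p where "p = (\<lambda>t. arccos (cos (k * (t - t0))) / k)"
  define Z where "Z = (\<lambda>T. {t \<in> {t0..T}. sin (k * (t - t0)) = 0})"
  have Z: "finite (Z T)" for T
  proof (rule finite_subset)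
    show "Z T \<subseteq> (\<lambda>i::int. t0 + of_int i * pi / k) ` {0..\<lceil>k * (T - t0) / pi\<rceil>}"
    proof
      fix t assume t: "t \<in> Z T"
      then obtain i :: int where i: "k * (t - t0) = of_int i * pi"
        unfolding Z_def sin_zero_iff_int2 by auto
      have "0 \<le> of_int i * pi" unfolding i[symmetric] using t k by (simp add: Z_def)
      then have "0 \<le> i" using pi_gt_zero by (auto simp: zero_le_mult_iff)
      moreover have "of_int i * pi \<le> k * (T - t0)"
        unfolding i[symmetric] using t k by (simp add: Z_def)
      then have "of_int i \<le> k * (T - t0) / pi" by (simp add: pos_le_divide_eq)
      then have "i \<le> \<lceil>k * (T - t0) / pi\<rceil>" by (meson ceiling_mono ceiling_of_int le_of_int_ceiling of_int_le_iff order_trans)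
      moreover have "t = t0 + of_int i * pi / k" using i k by (simp add: field_simps)
      ultimately show "t \<in> (\<lambda>i::int. t0 + of_int i * pi / k) ` {0..\<lceil>k * (T - t0) / pi\<rceil>}" by auto
    qed
  qed simp
  have cont: "isCont \<sigma> t" if "sin (k * (t - t0)) \<noteq> 0" for t
  proof -
    have *: "isCont (\<lambda>t. sin (k * (t - t0))) t" by (intro continuous_intros)
    have "\<exists>c. \<forall>\<^sub>F r in nhds t. \<sigma> r = c"
    proof (cases "sin (k * (t - t0)) > 0")
      case True
      then have "\<forall>\<^sub>F r in nhds t. sin (k * (r - t0)) > 0"
        using * by (metis isCont_def order_tendstoD(1) tendsto_at_iff_tendsto_nhds)
      then show ?thesis by (intro exI[of _ 1]) (auto simp: \<sigma>_def elim!: eventually_mono)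
    next
      case False
      then have "sin (k * (t - t0)) < 0" using that by simp
      then have "\<forall>\<^sub>F r in nhds t. sin (k * (r - t0)) < 0"
        using * by (metis isCont_def order_tendstoD(2) tendsto_at_iff_tendsto_nhds)
      then show ?thesis by (intro exI[of _ "-1"]) (auto simp: \<sigma>_def elim!: eventually_mono)
    qed
    then obtain c where "\<forall>\<^sub>F r in nhds t. \<sigma> r = c" by blast
    from isCont_cong[OF this] show ?thesis by simp
  qed
  have "{t \<in> {t0..T}. \<not> isCont \<sigma> t} \<subseteq> Z T" for T using cont by (auto simp: Z_def)
  then have "finite {t \<in> {t0..T}. \<not> isCont \<sigma> t}" for T using Z finite_subset by blast
  moreover have "range \<sigma> \<subseteq> {1, -1}" by (auto simp: \<sigma>_def)
  ultimately have ctrl: "(\<lambda>t\<in>{t0..}. \<sigma> t *\<^sub>R e) \<in> controls t0"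
    by (intro sign_control_in_controls[OF e(1)])
  have deriv: "(p has_vector_derivative \<sigma> t) (at t)" if "sin (k * (t - t0)) \<noteq> 0" for t
  proof -
    let ?w = "k * (t - t0)"
    have sc: "(cos ?w)\<^sup>2 < 1" using that sin_cos_squared_add[of ?w]
      by (smt (verit) zero_less_power2)
    then have c1: "-1 < cos ?w" "cos ?w < 1"
      by (auto simp: power2_less_1_iff abs_less_iff)
    have "((\<lambda>t. arccos (cos (k * (t - t0)))) has_real_derivative
        inverse (- sqrt (1 - (cos ?w)\<^sup>2)) * (- sin ?w * k)) (at t)"
      by (rule DERIV_chain2[where f = arccos and g = "\<lambda>t. cos (k * (t - t0))"])
        (use c1 in \<open>auto intro!: derivative_eq_intros\<close>)
    moreover have "sqrt (1 - (cos ?w)\<^sup>2) = \<bar>sin ?w\<bar>"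
      by (simp add: sin_squared_eq[symmetric])
    ultimately have "(p has_real_derivative inverse (- \<bar>sin ?w\<bar>) * (- sin ?w * k) / k) (at t)"
      unfolding p_def by (intro DERIV_cdivide) simp
    moreover have "inverse (- \<bar>sin ?w\<bar>) * (- sin ?w * k) / k = \<sigma> t"
      using that k by (auto simp: \<sigma>_def abs_if)
    ultimately show ?thesis by (simp add: has_real_derivative_iff_has_vector_derivative)
  qed
  have "trajectory 1 t0 z (\<lambda>t\<in>{t0..}. \<sigma> t *\<^sub>R e) t = z + p t *\<^sub>R e" if t: "t0 \<le> t" for t
  proof -
    have "(\<sigma> has_integral p t - p t0) {t0..t}"
    proof (rule fundamental_theorem_of_calculus_interior_strong[OF Z[of t] t])
      show "continuous_on {t0..t} p"
        unfolding p_def using k(1) by (intro continuous_intros) auto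
    qed (auto simp: Z_def intro!: deriv)
    moreover have "p t0 = 0" by (simp add: p_def)
    ultimately have "((\<lambda>t. \<sigma> t *\<^sub>R e) has_integral p t *\<^sub>R e) {t0..t}"
      using has_integral_scaleR_left by force
    then have "((\<lambda>t\<in>{t0..}. \<sigma> t *\<^sub>R e) has_integral p t *\<^sub>R e) {t0..t}"
      by (rule has_integral_eq[rotated]) auto
    then show ?thesis unfolding trajectory_def by (simp add: integral_unique)
  qed
  moreover have "z + p t *\<^sub>R e \<in> X" for t
  proof -
    have "0 \<le> p t" "p t \<le> pi / k"
      unfolding p_def using k(1) arccos_bounded[of "cos (k * (t - t0))"] by (auto simp: divide_right_mono)
    then show ?thesis using e(2) k(2) seg by auto
  qed
  ultimately show ?thesis using ctrl unfolding admissible_controls_def by auto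
qed

lemma straight_control:
  fixes e :: plane
  assumes "norm e = 1"
  shows "(\<lambda>t\<in>{t0..}. e) \<in> controls t0"
    and "t0 \<le> t \<Longrightarrow> trajectory 1 t0 x (\<lambda>t\<in>{t0..}. e) t = x + (t - t0) *\<^sub>R e"
proof -
  show "(\<lambda>t\<in>{t0..}. e) \<in> controls t0"
    using sign_control_in_controls[OF assms, of "\<lambda>_. 1" t0] by simp
  assume "t0 \<le> t"
  moreover have "integral {t0..t} (\<lambda>t\<in>{t0..}. e) = integral {t0..t} (\<lambda>_. e)"
    by (rule integral_cong) auto
  ultimately show "trajectory 1 t0 x (\<lambda>t\<in>{t0..}. e) t = x + (t - t0) *\<^sub>R e"
    unfolding trajectory_def by simp
qed

section \<open>The intrinsic metric\<close>

text \<open>A one-point region has no admissible control, since controls have norm 1. In the game it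
  is excluded by the two distinct initial positions.\<close>

locale region =
  fixes X :: "plane set"
  assumes star: "locally_star_shaped X" and conn: "connected X"
    and nontrivial: "\<And>x. X \<noteq> {x}"
begin

text \<open>A connected set with more than one point has no isolated points, so some nontrivial
  segment issues from \<open>z\<close> inside \<open>X\<close>, and the player can oscillate on
  it.\<close>

lemma admissible_control_exists:
  assumes "z \<in> X"
  shows "\<exists>u. u \<in> admissible_controls X 1 t0 z"
proof -
  obtain r where r: "r > 0" "\<And>y. y \<in> X \<Longrightarrow> dist z y < r \<Longrightarrow> closed_segment z y \<subseteq> X"
    using locally_star_shapedE[OF star assms] by blast
  have "z islimpt X" using conn assms nontrivial by (rule connected_imp_perfect)
  then obtain y where "y \<in> X" "y \<noteq> z" "dist y z < r"
    using r(1) unfolding islimpt_approachable by blast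
  then show ?thesis using oscillating_control r(2) by (metis dist_commute)
qed

text \<open>Run straight along the first segment and switch to a control for the rest of the chain.
  The rest starts later, hence the induction is over arbitrary \<open>t0\<close>.\<close>

lemma poly_chain_control:
  assumes "poly_chain X x y l"
  shows "\<exists>u\<in>admissible_controls X 1 t0 x. trajectory 1 t0 x u (t0 + l) = y"
  using assms
proof (induction arbitrary: t0 rule: poly_chain.induct)
  case (refl x)
  \<comment> \<open>The target is already reached; any admissible control continues the
    motion.\<close>
  then show ?case using admissible_control_exists by fastforce
next
  case (step x y z l)
  show ?case
  proof (cases "x = y")
    \<comment> \<open>A degenerate segment has no direction and takes no time.\<close>
    case True
    then show ?thesis using step.IH by simp
  next
    case False
    then obtain e where e: "norm e = 1" "y = x + dist x y *\<^sub>R e"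
      "\<And>r. 0 \<le> r \<Longrightarrow> r \<le> dist x y \<Longrightarrow> x + r *\<^sub>R e \<in> closed_segment x y"
      using unit_vector_towards by metis
    define u where "u = (\<lambda>t\<in>{t0..}. e)"
    define T where "T = t0 + dist x y"
    have T: "t0 \<le> T" by (simp add: T_def)
    have u: "u \<in> controls t0" "\<And>t. t0 \<le> t \<Longrightarrow> trajectory 1 t0 x u t = x + (t - t0) *\<^sub>R e"
      unfolding u_def using straight_control[OF e(1)] by auto
    have uT: "trajectory 1 t0 x u T = y" using u(2)[OF T] e(2) by (simp add: T_def)
    obtain v where v: "v \<in> admissible_controls X 1 T y" "trajectory 1 T y v (T + l) = z"
      using step.IH by blast
    have l: "0 \<le> l" using step poly_chain_nonneg by blast
    have "switch_control T u v \<in> admissible_controls X 1 t0 x"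
    proof (rule switch_control_admissible[OF T u(1)])
      show "trajectory 1 t0 x u t \<in> X" if "t \<in> {t0..T}" for t
        using that u(2) e(3)[of "t - t0"] step(1) by (auto simp: T_def)
    qed (use v uT in simp)
    moreover have "trajectory 1 t0 x (switch_control T u v) (T + l) = z"
      using trajectory_switch_after[OF T, of "T + l" u v] u(1) v l
      by (simp add: uT admissible_controls_def)
    ultimately show ?thesis by (intro bexI[of _ "switch_control T u v"]) (auto simp: T_def add.assoc)
  qed
qed

text \<open>The trajectory of a unit-speed control that follows the chain is a valid path of the
  required length.\<close>

lemma poly_chain_curve_length:
  assumes "poly_chain X x y l"
  shows "l \<in> curve_lengths X x y"
proof -
  obtain u where "u \<in> admissible_controls X 1 0 x" "trajectory 1 0 x u (0 + l) = y"
    using poly_chain_control[OF assms] by blast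
  then show ?thesis
    using trajectory_curve_length[of u X 1 0 x 0 l] poly_chain_nonneg[OF assms] by simp
qed

section \<open>Metric properties of \<open>dL\<close>\<close>

lemma dist_le_curve_length: "l \<in> curve_lengths X x y \<Longrightarrow> dist x y \<le> l"
  using poly_chain_below_curve[OF star] poly_chain_ge_dist by (meson order_trans)

lemma dL_le_curve_length: "l \<in> curve_lengths X x y \<Longrightarrow> dL X x y \<le> l"
  unfolding dL_def by (rule cInf_lower) (auto intro!: bdd_belowI dist_le_curve_length)

lemma dL_le_chain: "poly_chain X x y l \<Longrightarrow> dL X x y \<le> l"
  by (intro dL_le_curve_length poly_chain_curve_length)

lemma curve_lengths_nonempty: "x \<in> X \<Longrightarrow> y \<in> X \<Longrightarrow> curve_lengths X x y \<noteq> {}"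
  using poly_chain_exists[OF conn star] poly_chain_curve_length by blast

text \<open>Curves approach the infimum and chains are no longer than curves, so \<open>dL\<close>
  is also the infimum over chains. No shortest path has to be produced.\<close>

lemma chain_near_dL:
  assumes "x \<in> X" "y \<in> X" "dL X x y < c"
  shows "\<exists>l<c. poly_chain X x y l"
proof -
  obtain l where "l \<in> curve_lengths X x y" "l < c"
    using assms cInf_lessD[OF curve_lengths_nonempty] unfolding dL_def by metis
  then show ?thesis using poly_chain_below_curve[OF star] by (meson le_less_trans)
qed

lemma dist_le_dL: "x \<in> X \<Longrightarrow> y \<in> X \<Longrightarrow> dist x y \<le> dL X x y"
  unfolding dL_def by (intro cInf_greatest curve_lengths_nonempty dist_le_curve_length)

lemma dL_commute:
  assumes "x \<in> X" "y \<in> X"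
  shows "dL X x y = dL X y x"
proof -
  have "dL X b a \<le> dL X a b" if "a \<in> X" "b \<in> X" for a b
    using chain_near_dL[OF that] dL_le_chain poly_chain_sym by (meson le_less_trans not_le order_less_irrefl)
  then show ?thesis using assms by (meson antisym)
qed

lemma dL_triangle:
  assumes "x \<in> X" "y \<in> X" "z \<in> X"
  shows "dL X x z \<le> dL X x y + dL X y z"
proof (rule field_le_epsilon)
  fix e :: real assume e: "e > 0"
  obtain l where l: "l < dL X x y + e/2" "poly_chain X x y l"
    using chain_near_dL[OF assms(1,2), of "dL X x y + e/2"] e by auto
  obtain m where m: "m < dL X y z + e/2" "poly_chain X y z m"
    using chain_near_dL[OF assms(2,3), of "dL X y z + e/2"] e by auto
  show "dL X x z \<le> dL X x y + dL X y z + e"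
    using dL_le_chain[OF poly_chain_trans[OF l(2) m(2)]] l m by simp
qed

text \<open>Provides the shortness hypothesis of \<open>norm_gradient_le_1\<close> for
  \<open>dL X c\<close>.\<close>

lemma dL_segment_diff:
  assumes "c \<in> X" and seg: "closed_segment y z \<subseteq> X"
  shows "\<bar>dL X c y - dL X c z\<bar> \<le> dist y z"
proof -
  have yz: "y \<in> X" "z \<in> X" using seg by auto
  have "dL X y z \<le> dist y z" by (intro dL_le_chain poly_chain_segment seg)
  then show ?thesis
    using dL_triangle[OF assms(1) yz] dL_triangle[OF assms(1) yz(2,1)] dL_commute[OF yz] by simp
qed

lemma norm_gradient_dL_le_1:
  assumes "c \<in> X" "has_gradient_within (\<lambda>y. dL X c y) g X x"
  shows "norm g \<le> 1"
  using norm_gradient_le_1[OF star assms(2)] dL_segment_diff[OF assms(1)] by blast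

lemma dL_trajectory_le:
  assumes "u \<in> admissible_controls X s t0 x0" "0 \<le> s" "t0 \<le> a" "a \<le> b"
  shows "dL X (trajectory s t0 x0 u a) (trajectory s t0 x0 u b) \<le> s * (b - a)"
  by (intro dL_le_curve_length trajectory_curve_length assms)

lemma control_near_dL:
  assumes "x \<in> X" "y \<in> X" "dL X x y < c"
  shows "\<exists>u \<tau>. u \<in> admissible_controls X 1 t0 x \<and> 0 \<le> \<tau> \<and> dL X x y \<le> \<tau> \<and> \<tau> < c \<and>
    trajectory 1 t0 x u (t0 + \<tau>) = y"
proof -
  obtain l where "l < c" "poly_chain X x y l" using chain_near_dL[OF assms] by blast
  then show ?thesis using poly_chain_control[of x y l t0] poly_chain_nonneg dL_le_chain by blast
qed

section \<open>What capture by the evader's arrival forces on the pursuer\<close>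

text \<open>Capture at elapsed time \<open>s\<close> happens within distance \<tau> - s of
  \<open>c\<close>. The last condition on \<open>h\<close> excludes \<open>s < h\<close>, so at time
  \<open>h\<close> the pursuer is within \<alpha>(s - h) + (\<tau> - s) of \<open>c\<close>, which
  is at most \<alpha>(\<tau> - h). The terminal time is an infimum, so \<open>s\<close> is only
  known to be below \<tau> plus an arbitrary margin.\<close>

lemma capture_bound:
  assumes \<alpha>: "\<alpha> > 1" and xp: "xp \<in> X" and c: "c \<in> X"
    and up: "up \<in> admissible_controls X \<alpha> t0 xp"
    and ue: "ue \<in> admissible_controls X 1 t0 xe"
    and arrive: "trajectory 1 t0 xe ue (t0 + \<tau>) = c"
    and captured: "terminal_time \<alpha> t0 xp xe up ue \<le> ereal (t0 + \<tau>)"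
    and h: "0 \<le> h" "h \<le> \<tau>" "\<tau> + (\<alpha> - 1) * h \<le> dL X c xp"
  shows "dL X c (trajectory \<alpha> t0 xp up (t0 + h)) \<le> \<alpha> * (\<tau> - h)"
proof (rule field_le_epsilon)
  fix \<epsilon>' :: real assume "\<epsilon>' > 0"
  \<comment> \<open>If capture comes up to \<epsilon> after the arrival, the evader has gone up to
    \<epsilon> beyond \<open>c\<close> and the pursuer has gained up to \<alpha>\<epsilon>; the two
    sum to \<epsilon>'.\<close>
  define \<epsilon> where "\<epsilon> = \<epsilon>' / (\<alpha> + 1)"
  have \<epsilon>: "\<epsilon> > 0" "(\<alpha> + 1) * \<epsilon> = \<epsilon>'" using \<open>\<epsilon>' > 0\<close> \<alpha> by (auto simp: \<epsilon>_def)
  let ?p = "trajectory \<alpha> t0 xp up" and ?e = "trajectory 1 t0 xe ue"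
  have "terminal_time \<alpha> t0 xp xe up ue < ereal (t0 + \<tau> + \<epsilon>)"
    using captured \<epsilon>(1) by (simp add: le_less_trans)
  then obtain t where t: "t0 \<le> t" "?p t = ?e t" "t < t0 + \<tau> + \<epsilon>"
    unfolding terminal_time_def by (auto simp: Inf_less_iff)
  define s where "s = t - t0"
  have s: "0 \<le> s" "t = t0 + s" "s < \<tau> + \<epsilon>" using t by (auto simp: s_def)
  have inX: "?p r \<in> X" "?e r \<in> X" if "t0 \<le> r" for r
    using up ue that by (auto simp: admissible_controls_def)
  have ce: "dL X c (?p t) \<le> \<bar>\<tau> - s\<bar>"
  proof (cases "s \<le> \<tau>")
    case True
    then show ?thesis
      using dL_trajectory_le[OF ue, of t "t0 + \<tau>"] s arrive t(2) dL_commute[OF c inX(1)[OF t(1)]] by simp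
  next
    case False
    then show ?thesis
      using dL_trajectory_le[OF ue, of "t0 + \<tau>" t] s arrive t(2) h by simp
  qed
  \<comment> \<open>A meeting before \<open>h\<close> would give
    \<open>dL X c xp \<le> \<tau> + (\<alpha> - 1) * s\<close>, against the condition on
    \<open>h\<close>.\<close>
  have "h \<le> s"
  proof (rule ccontr)
    assume "\<not> h \<le> s"
    then have less: "s < h" by simp
    have "dL X xp (?p t) \<le> \<alpha> * s"
      using dL_trajectory_le[OF up, of t0 t] \<alpha> s by simp
    then have "dL X c xp \<le> (\<tau> - s) + \<alpha> * s"
      using dL_triangle[OF c inX(1)[OF t(1)] xp] dL_commute[OF xp inX(1)[OF t(1)]] ce less h by simp
    moreover have "(\<alpha> - 1) * s < (\<alpha> - 1) * h" using less \<alpha> by simp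
    ultimately show False using h(3) by (simp add: algebra_simps)
  qed
  have "dL X (?p (t0 + h)) (?p t) \<le> \<alpha> * (s - h)"
    using dL_trajectory_le[OF up, of "t0 + h" t] \<alpha> s h \<open>h \<le> s\<close> by simp
  moreover have hX: "?p (t0 + h) \<in> X" using inX h by simp
  ultimately have "dL X c (?p (t0 + h)) \<le> \<bar>\<tau> - s\<bar> + \<alpha> * (s - h)"
    using dL_triangle[OF c inX(1)[OF t(1)] hX] dL_commute[OF hX inX(1)[OF t(1)]] ce by simp
  also have "\<dots> \<le> \<alpha> * (\<tau> - h) + \<epsilon>'"
  proof (cases "s \<le> \<tau>")
    case True
    then have "0 \<le> (\<alpha> - 1) * (\<tau> - s)" using \<alpha> by simp
    then show ?thesis using True \<open>\<epsilon>' > 0\<close> by (simp add: algebra_simps)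
  next
    case False
    have "\<alpha> * (s - \<tau>) \<le> \<alpha> * \<epsilon>" using \<alpha> s by simp
    then show ?thesis using False s \<epsilon>(2) by (simp add: algebra_simps)
  qed
  finally show "dL X c (?p (t0 + h)) \<le> \<alpha> * (\<tau> - h) + \<epsilon>'" .
qed

end

section \<open>First-order analysis of the game\<close>

text \<open>Stability of the equality case of Cauchy-Schwarz: \<open>norm (p + a)\<close> is at most
  2\<zeta>. Passing from the inner product to this norm costs a square root, hence \<zeta> squared
  in the hypothesis.\<close>

lemma nearly_opposite:
  fixes p a b :: "'a::real_inner"
  assumes "norm p \<le> 1" "norm a \<le> 1" "norm b \<le> 1" "p \<bullet> a \<le> -1 + 2 * \<zeta>\<^sup>2" "0 \<le> \<zeta>"
  shows "\<bar>p \<bullet> b + a \<bullet> b\<bar> \<le> 2 * \<zeta>"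
proof -
  have "(norm (p + a))\<^sup>2 = (norm p)\<^sup>2 + (norm a)\<^sup>2 + 2 * (p \<bullet> a)"
    by (simp add: power2_norm_eq_inner inner_add_left inner_add_right inner_commute)
  also have "\<dots> \<le> 1 + 1 + 2 * (-1 + 2 * \<zeta>\<^sup>2)"
    using assms by (intro add_mono mult_left_mono) (auto simp: abs_square_le_1)
  finally have "(norm (p + a))\<^sup>2 \<le> (2 * \<zeta>)\<^sup>2" by (simp add: power_mult_distrib)
  then have "norm (p + a) \<le> 2 * \<zeta>" by (rule power2_le_imp_le) (use assms(5) in simp)
  then have "norm (p + a) * norm b \<le> 2 * \<zeta> * 1" using assms by (intro mult_mono) auto
  then show ?thesis using Cauchy_Schwarz_ineq2[of "p + a" b] by (simp add: inner_add_left)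
qed

lemma has_gradient_withinD:
  assumes "has_gradient_within f g S x" "0 < e"
  shows "\<exists>d>0. \<forall>y\<in>S. norm (y - x) < d \<longrightarrow> \<bar>f y - f x - (y - x) \<bullet> g\<bar> \<le> e * norm (y - x)"
  using assms unfolding has_gradient_within_def has_derivative_within_alt by (auto simp: real_norm_def)

text \<open>Differentiability of \<open>dL\<close> is given on the product
  \<open>X \<times> X\<close>; only the second argument varies in the game. Interior and closure of
  a product split into factors, so the condition on thin sets carries over.\<close>

lemma has_gradient_within_partial:
  assumes "has_gradient_within (\<lambda>(x, y). f x y) g (S \<times> T) (c, x)"
  shows "has_gradient_within (f c) (snd g) T x"
proof -
  have c: "c \<in> S" "x \<in> T" "x \<in> closure (interior T)"
    and f: "((\<lambda>(x, y). f x y) has_derivative (\<lambda>h. h \<bullet> g)) (at (c, x) within S \<times> T)"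
    using assms unfolding has_gradient_within_def interior_Times closure_Times by auto
  have "((\<lambda>y. (c, y)) has_derivative (\<lambda>h. (0, h))) (at x within T)"
    by (intro has_derivative_Pair has_derivative_const has_derivative_ident)
  moreover have "((\<lambda>(x, y). f x y) has_derivative (\<lambda>h. h \<bullet> g)) (at (c, x) within (\<lambda>y. (c, y)) ` T)"
    by (rule has_derivative_subset[OF f]) (use c in auto)
  ultimately have "((\<lambda>y. case (c, y) of (x, y) \<Rightarrow> f x y) has_derivative (\<lambda>h. (0, h) \<bullet> g)) (at x within T)"
    by (rule has_derivative_in_compose)
  then show ?thesis
    using c unfolding has_gradient_within_def by (simp add: inner_prod_def)
qed

lemma trajectory_cong_AE:
  assumes "AE r in lborel. r \<in> {t0..t} \<longrightarrow> u r = v r"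
  shows "trajectory s t0 x0 u t = trajectory s t0 x0 v t"
proof -
  have "AE r in lebesgue. r \<in> {t0..t} \<longrightarrow> u r = v r" using assms by (rule AE_completion)
  then obtain N where N: "N \<in> null_sets lebesgue" "{r. \<not> (r \<in> {t0..t} \<longrightarrow> u r = v r)} \<subseteq> N"
    unfolding eventually_ae_filter by auto
  have "integral {t0..t} u = integral {t0..t} v"
    by (rule integral_spike[of N]) (use N in \<open>auto simp: negligible_iff_null_sets\<close>)
  then show ?thesis by (simp add: trajectory_def)
qed

context region
begin

text \<open>Here \<open>p\<close> and \<open>e\<close> are the positions at time
  \<open>t0 + h\<close> when the evader heads for \<open>c1\<close>. The bounds for
  \<open>c1\<close> come from letting it continue, the bound for \<open>c2\<close> from redirecting
  it at that moment; non-anticipation gives the same \<open>p\<close> in both plays.\<close>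

lemma pursuer_first_step:
  assumes \<alpha>: "\<alpha> > 1" and X: "xp \<in> X" "xe \<in> X" "c1 \<in> X" "c2 \<in> X"
    and d1: "dL X c1 xp = \<alpha> * dL X c1 xe" and d2: "dL X c2 xp = \<alpha> * dL X c2 xe"
    and \<delta>: "\<delta> \<in> nonanticipative_strategies X \<alpha> t0 xp xe"
    and win: "\<And>ue t. ue \<in> admissible_controls X 1 t0 xe \<Longrightarrow> t0 \<le> t \<Longrightarrow>
       ereal t < terminal_time \<alpha> t0 xp xe (\<delta> ue) ue \<Longrightarrow>
       trajectory 1 t0 xe ue t \<in> dominance X \<alpha> xp xe"
    and h: "0 < h" "h \<le> 1" "(\<alpha> + 2) * h \<le> (\<alpha> - 1) * dL X c1 xe" "(\<alpha> + 2) * h \<le> (\<alpha> - 1) * dL X c2 xe"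
  shows "\<exists>p\<in>X. \<exists>e\<in>X. norm (p - xp) \<le> \<alpha> * h \<and> norm (e - xe) \<le> h \<and>
    dL X c1 p \<le> \<alpha> * (dL X c1 xe + h\<^sup>2 - h) \<and> dL X c1 e \<le> dL X c1 xe + h\<^sup>2 - h \<and>
    dL X c2 p \<le> \<alpha> * (dL X c2 e + h\<^sup>2)"
proof -
  let ?T = "t0 + h"
  have hh: "h\<^sup>2 \<le> h" "0 < h\<^sup>2" using h by (auto simp: power2_eq_square mult_left_le_one_le)
  have nodom: "c1 \<notin> dominance X \<alpha> xp xe" "c2 \<notin> dominance X \<alpha> xp xe"
    using d1 d2 by (auto simp: dominance_def)
  \<comment> \<open>Standing at \<open>c1\<close> or \<open>c2\<close> the evader is outside the
    open condition defining the dominance region, so the winning property fails there unless the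
    game is over.\<close>
  have captured: "terminal_time \<alpha> t0 xp xe (\<delta> ue) ue \<le> ereal (t0 + \<tau>)"
    if "ue \<in> admissible_controls X 1 t0 xe" "trajectory 1 t0 xe ue (t0 + \<tau>) \<in> {c1, c2}" "0 \<le> \<tau>" for ue \<tau>
    using win[OF that(1), of "t0 + \<tau>"] nodom that by (auto simp: not_less[symmetric])
  have \<delta>_adm: "\<delta> ue \<in> admissible_controls X \<alpha> t0 xp" if "ue \<in> admissible_controls X 1 t0 xe" for ue
    using \<delta> that unfolding nonanticipative_strategies_def by blast
  \<comment> \<open>The slack for an almost shortest path is of order \<open>h\<^sup>2\<close>,
    negligible against the step \<open>h\<close>.\<close>
  have "dL X xe c1 < dL X c1 xe + h\<^sup>2" using hh dL_commute[OF X(2,3)] by simp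
  then obtain u1 \<tau>1 where u1: "u1 \<in> admissible_controls X 1 t0 xe" "dL X xe c1 \<le> \<tau>1"
      "\<tau>1 < dL X c1 xe + h\<^sup>2" "trajectory 1 t0 xe u1 (t0 + \<tau>1) = c1"
    using control_near_dL[OF X(2,3), of _ t0] by blast
  have u1c: "u1 \<in> controls t0" using u1 by (simp add: admissible_controls_def)
  have "(\<alpha> - 1) * h \<le> (\<alpha> - 1) * dL X c1 xe" using h \<alpha> by (simp add: algebra_simps)
  then have hT1: "h \<le> \<tau>1" using \<alpha> u1(2) dL_commute[OF X(2,3)] by simp
  define e where "e = trajectory 1 t0 xe u1 ?T"
  have e: "e \<in> X" using u1(1) h by (simp add: e_def admissible_controls_def)
  have e_dist: "norm (e - xe) \<le> h"
    using trajectory_dist_le[OF u1c, of t0 ?T 1 xe] h by (simp add: e_def dist_norm norm_minus_commute)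
  have e1: "dL X c1 e \<le> \<tau>1 - h"
    using dL_trajectory_le[OF u1(1), of ?T "t0 + \<tau>1"] u1(4) hT1 h dL_commute[OF X(3) e]
    by (simp add: e_def)
  define p where "p = trajectory \<alpha> t0 xp (\<delta> u1) ?T"
  have p: "p \<in> X" using \<delta>_adm[OF u1(1)] h by (simp add: p_def admissible_controls_def)
  have p_dist: "norm (p - xp) \<le> \<alpha> * h"
    using trajectory_dist_le[of "\<delta> u1" t0 t0 ?T \<alpha> xp] \<delta>_adm[OF u1(1)] h \<alpha>
    by (simp add: p_def dist_norm norm_minus_commute admissible_controls_def)
  have p1: "dL X c1 p \<le> \<alpha> * (\<tau>1 - h)"
    unfolding p_def
  proof (rule capture_bound[OF \<alpha> X(1,3) \<delta>_adm[OF u1(1)] u1(1,4) captured])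
    show "\<tau>1 + (\<alpha> - 1) * h \<le> dL X c1 xp"
      unfolding d1 using u1(3) hh h by (simp add: algebra_simps)
  qed (use u1 h hT1 in auto)
  have "dL X e c2 < dL X c2 e + h\<^sup>2" using hh dL_commute[OF e X(4)] by simp
  then obtain u2 \<tau>2 where u2: "u2 \<in> admissible_controls X 1 ?T e" "0 \<le> \<tau>2"
      "\<tau>2 < dL X c2 e + h\<^sup>2" "trajectory 1 ?T e u2 (?T + \<tau>2) = c2"
    using control_near_dL[OF e X(4), of _ ?T] by blast
  define w where "w = switch_control ?T u1 u2"
  have w: "w \<in> admissible_controls X 1 t0 xe"
    unfolding w_def using h u1(1) u2(1) by (intro admissible_switch_control) (auto simp: e_def)
  have w_arrive: "trajectory 1 t0 xe w (t0 + (h + \<tau>2)) = c2"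
    using trajectory_switch_after[of t0 ?T "?T + \<tau>2" u1 u2 1 xe] u1c u2 h
    by (simp add: w_def e_def[symmetric] admissible_controls_def add.assoc)
  \<comment> \<open>\<open>w\<close> and \<open>u1\<close> can differ on this interval only at its
    right end, where \<open>w\<close> has already switched.\<close>
  have "AE r in lborel. r \<in> {t0..?T} \<longrightarrow> u1 r = w r"
    using AE_lborel_singleton[of ?T] by eventually_elim (auto simp: w_def switch_control_def)
  then have "AE r in lborel. r \<in> {t0..?T} \<longrightarrow> \<delta> u1 r = \<delta> w r"
    using \<delta> u1(1) w less_add_same_cancel1[THEN iffD2, OF h(1), of t0]
    unfolding nonanticipative_strategies_def by blast
  then have pw: "p = trajectory \<alpha> t0 xp (\<delta> w) ?T"
    unfolding p_def by (rule trajectory_cong_AE)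
  have "dL X xe e \<le> h"
    using dL_trajectory_le[OF u1(1), of t0 ?T] h by (simp add: e_def)
  then have e2: "dL X c2 e \<le> dL X c2 xe + h"
    using dL_triangle[OF X(4,2) e] by simp
  have "dL X c2 p \<le> \<alpha> * (h + \<tau>2 - h)"
    unfolding pw
  proof (rule capture_bound[OF \<alpha> X(1,4) \<delta>_adm[OF w] w w_arrive captured[OF w]])
    \<comment> \<open>Origin of \<alpha> + 2: the first move and the detour it causes cost
      \<open>h\<close> each, the slack \<open>h\<^sup>2\<close> at most \<open>h\<close>, and the
      condition of \<open>capture_bound\<close> adds (\<alpha> - 1)h.\<close>
    have "h + \<tau>2 + (\<alpha> - 1) * h \<le> dL X c2 xe + (\<alpha> + 2) * h"
      using u2(3) e2 hh by (simp add: algebra_simps)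
    also have "\<dots> \<le> dL X c2 xp" unfolding d2 using h(4) by (simp add: algebra_simps)
    finally show "h + \<tau>2 + (\<alpha> - 1) * h \<le> dL X c2 xp" .
  qed (use u2 h w_arrive in auto)
  also have "\<dots> \<le> \<alpha> * (dL X c2 e + h\<^sup>2)" using u2 \<alpha> by simp
  finally have p2: "dL X c2 p \<le> \<alpha> * (dL X c2 e + h\<^sup>2)" .
  have "dL X c1 p \<le> \<alpha> * (dL X c1 xe + h\<^sup>2 - h)"
    using p1 by (rule order_trans) (use u1(3) \<alpha> in simp)
  with p2 show ?thesis using p e p_dist e_dist e1 u1(3) by (intro bexI[of _ p] bexI[of _ e]) auto
qed

text \<open>The inequality is shown up to an error 7\<zeta> for every small \<zeta>, by linearizing
  the bounds of \<open>pursuer_first_step\<close>. The normalized moves of the players are close to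
  \<open>- a1\<close> and \<open>- b1\<close>, and comparing distances to \<open>c2\<close> along
  them gives the claim.\<close>

lemma gradient_inequality:
  assumes \<alpha>: "\<alpha> > 1" and X: "xp \<in> X" "xe \<in> X" "c1 \<in> X" "c2 \<in> X" and ne: "xp \<noteq> xe"
    and d1: "dL X c1 xp = \<alpha> * dL X c1 xe" and d2: "dL X c2 xp = \<alpha> * dL X c2 xe"
    and \<delta>: "\<delta> \<in> nonanticipative_strategies X \<alpha> t0 xp xe"
    and win: "\<And>ue t. ue \<in> admissible_controls X 1 t0 xe \<Longrightarrow> t0 \<le> t \<Longrightarrow>
       ereal t < terminal_time \<alpha> t0 xp xe (\<delta> ue) ue \<Longrightarrow>
       trajectory 1 t0 xe ue t \<in> dominance X \<alpha> xp xe"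
    and a1: "has_gradient_within (dL X c1) a1 X xp" and a2: "has_gradient_within (dL X c2) a2 X xp"
    and b1: "has_gradient_within (dL X c1) b1 X xe" and b2: "has_gradient_within (dL X c2) b2 X xe"
  shows "a1 \<bullet> a2 - b1 \<bullet> b2 \<ge> 0"
proof -
  \<comment> \<open>If \<open>dL X c xe\<close> vanished, so would \<open>dL X c xp\<close>, and
    both players would start at \<open>c\<close>. Positivity leaves room for a positive step
    \<open>h\<close>.\<close>
  have pos: "0 < dL X c xe" if "c \<in> X" "dL X c xp = \<alpha> * dL X c xe" for c
  proof -
    have "0 \<le> dL X c xe" using dist_le_dL[OF that(1) X(2)] zero_le_dist order_trans by blast
    moreover have "dL X c xe \<noteq> 0"
      using dist_le_dL[OF that(1) X(2)] dist_le_dL[OF that(1) X(1)] that(2) ne by auto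
    ultimately show ?thesis by simp
  qed
  have norms: "norm a1 \<le> 1" "norm a2 \<le> 1" "norm b1 \<le> 1" "norm b2 \<le> 1"
    using norm_gradient_dL_le_1[OF X(3)] norm_gradient_dL_le_1[OF X(4)] a1 a2 b1 b2 by auto
  have approx: "a1 \<bullet> a2 - b1 \<bullet> b2 \<ge> - 7 * \<zeta>" if \<zeta>: "0 < \<zeta>" "\<zeta> \<le> 1" for \<zeta> :: real
  proof -
    \<comment> \<open>The square compensates the square root lost in
      \<open>nearly_opposite\<close>.\<close>
    define \<eta> where "\<eta> = \<zeta>\<^sup>2"
    have \<eta>: "0 < \<eta>" "\<eta> \<le> \<zeta>" "\<eta> \<le> 1"
      using \<zeta> by (auto simp: \<eta>_def power2_eq_square mult_left_le_one_le mult_le_one)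
    obtain r1 where r1: "r1 > 0" and A1: "\<And>y. y \<in> X \<Longrightarrow> norm (y - xp) < r1 \<Longrightarrow>
        \<bar>dL X c1 y - dL X c1 xp - (y - xp) \<bullet> a1\<bar> \<le> \<eta> * norm (y - xp)"
      using has_gradient_withinD[OF a1 \<eta>(1)] by blast
    obtain r2 where r2: "r2 > 0" and A2: "\<And>y. y \<in> X \<Longrightarrow> norm (y - xp) < r2 \<Longrightarrow>
        \<bar>dL X c2 y - dL X c2 xp - (y - xp) \<bullet> a2\<bar> \<le> \<eta> * norm (y - xp)"
      using has_gradient_withinD[OF a2 \<eta>(1)] by blast
    obtain r3 where r3: "r3 > 0" and B1: "\<And>y. y \<in> X \<Longrightarrow> norm (y - xe) < r3 \<Longrightarrow>
        \<bar>dL X c1 y - dL X c1 xe - (y - xe) \<bullet> b1\<bar> \<le> \<eta> * norm (y - xe)"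
      using has_gradient_withinD[OF b1 \<eta>(1)] by blast
    obtain r4 where r4: "r4 > 0" and B2: "\<And>y. y \<in> X \<Longrightarrow> norm (y - xe) < r4 \<Longrightarrow>
        \<bar>dL X c2 y - dL X c2 xe - (y - xe) \<bullet> b2\<bar> \<le> \<eta> * norm (y - xe)"
      using has_gradient_withinD[OF b2 \<eta>(1)] by blast
    \<comment> \<open>With \<open>h = M / (\<alpha> + 2)\<close> both moves stay inside the radii of
      linearization, the time conditions of \<open>pursuer_first_step\<close> hold, and the slack
      \<open>h\<^sup>2\<close> is at most \<eta>h.\<close>
    define M where "M = Min {r1 / 2, r2 / 2, r3 / 2, r4 / 2, (\<alpha> - 1) * dL X c1 xe, (\<alpha> - 1) * dL X c2 xe, \<eta>}"
    have "M \<le> r1 / 2" "M \<le> r2 / 2" "M \<le> r3 / 2" "M \<le> r4 / 2"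
      "M \<le> (\<alpha> - 1) * dL X c1 xe" "M \<le> (\<alpha> - 1) * dL X c2 xe" "M \<le> \<eta>"
      unfolding M_def by (rule Min_le; simp)+
    moreover have "0 < M"
      unfolding M_def using r1 r2 r3 r4 \<eta> \<alpha> pos[OF X(3) d1] pos[OF X(4) d2] by (subst Min_gr_iff) auto
    ultimately have M: "0 < M" "M < r1" "M < r2" "M < r3" "M < r4" "M \<le> (\<alpha> - 1) * dL X c1 xe"
      "M \<le> (\<alpha> - 1) * dL X c2 xe" "M \<le> \<eta>"
      using r1 r2 r3 r4 by auto
    define h where "h = M / (\<alpha> + 2)"
    have hM: "(\<alpha> + 2) * h = M" and h: "0 < h" using \<alpha> M by (auto simp: h_def)
    have \<alpha>h: "h < \<alpha> * h" "\<alpha> * h < M"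
      using h \<alpha> by (simp_all add: hM[symmetric] algebra_simps)
    have h\<eta>: "h \<le> \<eta>" "h \<le> 1" using \<alpha>h M \<eta> by auto
    obtain p e where pe: "p \<in> X" "e \<in> X" and pn: "norm (p - xp) \<le> \<alpha> * h" and en: "norm (e - xe) \<le> h"
      and p1: "dL X c1 p \<le> \<alpha> * (dL X c1 xe + h\<^sup>2 - h)" and e1: "dL X c1 e \<le> dL X c1 xe + h\<^sup>2 - h"
      and p2: "dL X c2 p \<le> \<alpha> * (dL X c2 e + h\<^sup>2)"
      using pursuer_first_step[OF \<alpha> X d1 d2 \<delta> win h h\<eta>(2)] hM M by force
    have hh: "h\<^sup>2 \<le> \<eta> * h" using h h\<eta> by (simp add: power2_eq_square)
    have \<alpha>hh: "\<alpha> * h\<^sup>2 \<le> \<alpha> * (\<eta> * h)" using hh \<alpha> by simp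
    have pn': "\<eta> * norm (p - xp) \<le> \<alpha> * (\<eta> * h)" and en': "\<eta> * norm (e - xe) \<le> \<eta> * h"
      using mult_left_mono[OF pn, of \<eta>] mult_left_mono[OF en, of \<eta>] \<eta> by (auto simp: mult_ac)
    have nr: "norm (p - xp) < r1" "norm (p - xp) < r2" "norm (e - xe) < r3" "norm (e - xe) < r4"
      using pn en \<alpha>h M by linarith+
    \<comment> \<open>One \<eta> is the linearization error, the other pays for the slack
      \<open>h\<^sup>2\<close>.\<close>
    have "(p - xp) \<bullet> a1 \<le> dL X c1 p - dL X c1 xp + \<alpha> * (\<eta> * h)"
      using A1[OF pe(1) nr(1)] pn' by linarith
    also have "\<dots> \<le> \<alpha> * h * (-1 + 2 * \<eta>)"
      using p1 d1 \<alpha>hh by (simp add: algebra_simps)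
    finally have P1: "(p - xp) \<bullet> a1 \<le> \<alpha> * h * (-1 + 2 * \<eta>)" .
    have "(e - xe) \<bullet> b1 \<le> dL X c1 e - dL X c1 xe + \<eta> * h"
      using B1[OF pe(2) nr(3)] en' by linarith
    also have "\<dots> \<le> h * (-1 + 2 * \<eta>)"
      using e1 hh by (simp add: algebra_simps)
    finally have E1: "(e - xe) \<bullet> b1 \<le> h * (-1 + 2 * \<eta>)" .
    have E2: "dL X c2 e - dL X c2 xe \<le> (e - xe) \<bullet> b2 + \<eta> * h"
      using B2[OF pe(2) nr(4)] en' by linarith
    \<comment> \<open>The three errors are the linearizations at \<open>xp\<close> and at
      \<open>xe\<close> and the slack of the path to \<open>c2\<close>.\<close>
    have "(p - xp) \<bullet> a2 \<le> dL X c2 p - dL X c2 xp + \<alpha> * (\<eta> * h)"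
      using A2[OF pe(1) nr(2)] pn' by linarith
    also have "\<dots> \<le> \<alpha> * (dL X c2 e - dL X c2 xe) + 2 * (\<alpha> * (\<eta> * h))"
      using p2 d2 \<alpha>hh by (simp add: algebra_simps)
    also have "\<dots> \<le> \<alpha> * ((e - xe) \<bullet> b2 + \<eta> * h) + 2 * (\<alpha> * (\<eta> * h))"
      using E2 \<alpha> by simp
    finally have P2: "(p - xp) \<bullet> a2 \<le> \<alpha> * ((e - xe) \<bullet> b2 + 3 * (\<eta> * h))"
      by (simp add: algebra_simps)
    \<comment> \<open>Displacements divided by the maximal distances \<alpha>h and h: vectors of
      norm at most 1 whose inner products with \<open>a1\<close> and \<open>b1\<close> are almost
      -1.\<close>
    define P Q where "P = (p - xp) /\<^sub>R (\<alpha> * h)" and "Q = (e - xe) /\<^sub>R h"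
    have \<alpha>h0: "0 < \<alpha> * h" using h \<alpha> by simp
    have P: "norm P = norm (p - xp) / (\<alpha> * h)" "P \<bullet> w = (p - xp) \<bullet> w / (\<alpha> * h)" for w
      using \<alpha>h0 unfolding P_def by (simp_all add: divide_inverse mult.commute del: inverse_mult_distrib)
    have Q: "norm Q = norm (e - xe) / h" "Q \<bullet> w = (e - xe) \<bullet> w / h" for w
      using h unfolding Q_def by (simp_all add: divide_inverse mult.commute)
    have PQ: "norm P \<le> 1" "norm Q \<le> 1" "P \<bullet> a1 \<le> -1 + 2 * \<zeta>\<^sup>2" "Q \<bullet> b1 \<le> -1 + 2 * \<zeta>\<^sup>2"
      unfolding P Q pos_divide_le_eq[OF \<alpha>h0] pos_divide_le_eq[OF h] \<eta>_def[symmetric]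
      using pn en P1 E1 by (simp_all add: mult.commute)
    have hQ: "h * (Q \<bullet> b2) = (e - xe) \<bullet> b2" using h by (simp add: Q(2))
    have "(p - xp) \<bullet> a2 \<le> (\<alpha> * h) * (Q \<bullet> b2 + 3 * \<eta>)"
      using P2 unfolding hQ[symmetric] by (simp add: algebra_simps)
    then have "P \<bullet> a2 \<le> Q \<bullet> b2 + 3 * \<eta>"
      unfolding P pos_divide_le_eq[OF \<alpha>h0] by (simp only: mult.commute)
    \<comment> \<open>Replacing \<open>P\<close> by \<open>- a1\<close> and \<open>Q\<close> by
      \<open>- b1\<close> costs 2\<zeta> each; with 3\<eta> this makes at most 7\<zeta>.\<close>
    moreover have "\<bar>P \<bullet> a2 + a1 \<bullet> a2\<bar> \<le> 2 * \<zeta>" "\<bar>Q \<bullet> b2 + b1 \<bullet> b2\<bar> \<le> 2 * \<zeta>"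
      using PQ norms \<zeta> by (auto intro!: nearly_opposite)
    ultimately show ?thesis using \<eta> by (simp add: abs_le_iff)
  qed
  show ?thesis
  proof (rule ccontr)
    define v where "v = a1 \<bullet> a2 - b1 \<bullet> b2"
    assume "\<not> ?thesis"
    then have "v < 0" by (simp add: v_def)
    \<comment> \<open>For \<zeta> = -v/14 the estimate reads v \<ge> v/2, impossible for negative
      \<open>v\<close>; if this \<zeta> is not below 1, taking 1 instead gives v \<ge> -7.\<close>
    then show False
      using approx[of 1] approx[of "- v / 14"] by (cases "v \<le> - 14") (auto simp: v_def[symmetric])
  qed
qed

end

theorem theorem14:
  fixes X :: "plane set" and \<alpha> t0 :: real and xp0 xe0 xc1 xc2 :: plane
  assumes "polygonal_region X"
    and "\<alpha> > 1"
    and "xp0 \<in> X" and "xe0 \<in> X" and "xp0 \<noteq> xe0"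
    and "xc1 \<in> dominance_boundary X \<alpha> xp0 xe0"
    and "xc2 \<in> dominance_boundary X \<alpha> xp0 xe0"
    and "continuously_differentiable_near (\<lambda>(x, y). dL X x y) (X \<times> X) (xc1, xp0)"
    and "continuously_differentiable_near (\<lambda>(x, y). dL X x y) (X \<times> X) (xc2, xp0)"
    and "\<exists>g. has_gradient_within (\<lambda>y. dL X xc1 y) g X xe0"
    and "\<exists>g. has_gradient_within (\<lambda>y. dL X xc2 y) g X xe0"
    and "\<exists>\<delta> \<in> nonanticipative_strategies X \<alpha> t0 xp0 xe0.
           \<forall>ue \<in> admissible_controls X 1 t0 xe0.
             \<forall>t. t0 \<le> t \<and> ereal t < terminal_time \<alpha> t0 xp0 xe0 (\<delta> ue) ue \<longrightarrow>
               trajectory 1 t0 xe0 ue t \<in> dominance X \<alpha> xp0 xe0"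
  shows "grad2_dL X xc1 xp0 \<bullet> grad2_dL X xc2 xp0
           - grad2_dL X xc1 xe0 \<bullet> grad2_dL X xc2 xe0 \<ge> 0"
proof -
  have star: "locally_star_shaped X"
    using assms(1) by (rule polygonal_imp_locally_star_shaped)
  interpret region X
    using star assms(1,3-5) by unfold_locales (auto simp: polygonal_region_def)
  have xc: "xc1 \<in> X" "xc2 \<in> X" "dL X xc1 xp0 = \<alpha> * dL X xc1 xe0" "dL X xc2 xp0 = \<alpha> * dL X xc2 xe0"
    using assms(6,7) by (auto simp: dominance_boundary_def)
  \<comment> \<open>The gradient at the point itself is read off from continuous differentiability
    near it and then restricted to the second argument.\<close>
  have grad: "\<exists>g. has_gradient_within (dL X c) g X xp0"
    if "c \<in> X" "continuously_differentiable_near (\<lambda>(x, y). dL X x y) (X \<times> X) (c, xp0)" for c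
    using that assms(3) has_gradient_within_partial
    unfolding continuously_differentiable_near_def by blast
  obtain a1 a2 b1 b2 where ab: "has_gradient_within (dL X xc1) a1 X xp0"
    "has_gradient_within (dL X xc2) a2 X xp0"
    "has_gradient_within (dL X xc1) b1 X xe0" "has_gradient_within (dL X xc2) b2 X xe0"
    using grad[OF xc(1) assms(8)] grad[OF xc(2) assms(9)] assms(10,11) by auto
  obtain \<delta> where \<delta>: "\<delta> \<in> nonanticipative_strategies X \<alpha> t0 xp0 xe0"
    and win: "\<And>ue t. ue \<in> admissible_controls X 1 t0 xe0 \<Longrightarrow> t0 \<le> t \<Longrightarrow>
       ereal t < terminal_time \<alpha> t0 xp0 xe0 (\<delta> ue) ue \<Longrightarrow>
       trajectory 1 t0 xe0 ue t \<in> dominance X \<alpha> xp0 xe0"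
    using assms(12) by blast
  have "a1 \<bullet> a2 - b1 \<bullet> b2 \<ge> 0"
    by (rule gradient_inequality[OF assms(2-4) xc(1,2) assms(5) xc(3,4) \<delta> win ab])
  then show ?thesis using ab[THEN grad2_dL_eqI[OF star]] by simp
qed

end
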